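(* The intermediary obtains strictly greater profits by collecting anonymized consumer data than by collecting complete (identity-revealing) consumer data: $R(A)>R(S)$.
   Context: There are many consumers $i=1,\dots,N$, one producer and one data intermediary. The vectors $w=(w_1,\dots,w_N)$ (willingness to pay) and $e=(e_1,\dots,e_N)$ (errors) are independent of each other, each has a distribution that is symmetric across consumers, with $\mathbb E[w_i]=\mu$, $\operatorname{var}[w_i]=1$, $\mathbb E[e_i]=0$, $\operatorname{var}[e_i]=1$; the distributions are otherwise arbitrary. Consumer $i$ observes $s_i=w_i+\sigma e_i$, $\sigma>0$; $S_i$ denotes the information $s_i$. Inflow policies: complete data $X=S=(s_1,\dots,s_N)$, with $X_{-i}=S_{-i}=(s_j)_{j\ne i}$; anonymized data $X=A$, a uniformly random permutation (independent of everything else) of the entries of $S$, with $X_{-i}=A_{-i}$ a uniformly random permutation of the entries of $S_{-i}$. $\varnothing$ denotes no information. Product market: facing unit price $p_i$, consumer $i$ buys $q_i$ with utility $w_iq_i-p_iq_i-\tfrac12q_i^2$; the producer's profit from $i$ is $(p_i-c)q_i$, $c\ge 0$. When consumer $i$ has information $I$ and the producer has information $Y_0$ (no finer than $I$), $p_i^*=\tfrac12(\mathbb E[w_i\mid Y_0]+c)$, $q_i^*=\mathbb E[w_i\mid I]-p_i^*$; $\Pi_i(I,Y_0)=\mathbb E[(p_i^*-c)q_i^*]$ and $U_i(I,Y_0)=\mathbb E[w_iq_i^*-p_i^*q_i^*-\tfrac12(q_i^* )^2]$. Data market: in equilibrium all collected data are transmitted to the producer and to all consumers. The producer pays $m_0^*(X)=\sum_{i}\big(\Pi_i((S_i,X),X)-\Pi_i(S_i,\varnothing)\big)$;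 consumer $i$ is paid $m_i^*(X)=U_i((S_i,X_{-i}),X_{-i})-U_i((S_i,X),X)$ (if she refuses, only $X_{-i}$ is collected and it is still transmitted to everybody). The intermediary's profit is $R(X)=m_0^*(X)-\sum_i m_i^*(X)$.
   Formalization: The formal theorem additionally assumes that the consumers' willingness to pay w_1,…,w_N are not all almost surely equal; if they all coincide almost surely, then R(A)=R(S) and the strict inequality fails. *)

theory Defs
  imports "HOL-Probability.Probability" "HOL-Combinatorics.Permutations"
begin

text \<open>
  Consumers are indexed by a finite set \<open>I\<close> of naturals; a vector of characteristics or signals
  is a family \<open>x :: nat \<Rightarrow> 'a \<Rightarrow> real\<close> of real random variables on \<open>M\<close>, read off on \<open>I\<close>.
\<close>

definition profile :: "nat set \<Rightarrow> (nat \<Rightarrow> 'a \<Rightarrow> real) \<Rightarrow> 'a \<Rightarrow> nat \<Rightarrow> real" where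
  "profile I x = (\<lambda>\<omega>. \<lambda>i\<in>I. x i \<omega>)"

abbreviation profile_space :: "nat set \<Rightarrow> (nat \<Rightarrow> real) measure" where
  "profile_space I \<equiv> PiM I (\<lambda>_. borel)"

definition symmetric_distr :: "'a measure \<Rightarrow> nat set \<Rightarrow> (nat \<Rightarrow> 'a \<Rightarrow> real) \<Rightarrow> bool" where
  "symmetric_distr M I x \<longleftrightarrow>
     (\<forall>p. p permutes I \<longrightarrow>
        distr M (profile_space I) (profile I (\<lambda>i. x (p i))) = distr M (profile_space I) (profile I x))"

definition uniform_permutation :: "'a measure \<Rightarrow> nat set \<Rightarrow> ('a \<Rightarrow> nat \<Rightarrow> nat) \<Rightarrow> bool" where
  "uniform_permutation M I \<rho> \<longleftrightarrow>
     \<rho> \<in> M \<rightarrow>\<^sub>M count_space {p. p permutes I} \<and>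
     distr M (count_space {p. p permutes I}) \<rho> = uniform_count_measure {p. p permutes I}"

definition signal ::
  "real \<Rightarrow> (nat \<Rightarrow> 'a \<Rightarrow> real) \<Rightarrow> (nat \<Rightarrow> 'a \<Rightarrow> real) \<Rightarrow> nat \<Rightarrow> 'a \<Rightarrow> real" where
  "signal \<sigma> w e i = (\<lambda>\<omega>. w i \<omega> + \<sigma> * e i \<omega>)"

text \<open>
  Information is a sub-\<open>\<sigma>\<close>-algebra of \<open>M\<close>, carried by a value of type \<open>'a measure\<close> of which
  only the space and the measurable sets matter.
\<close>

definition no_info :: "'a measure \<Rightarrow> 'a measure" where
  "no_info M = sigma (space M) {}"

definition info_join :: "'a measure \<Rightarrow> 'a measure \<Rightarrow> 'a measure" where
  "info_join F G = sigma (space F) (sets F \<union> sets G)"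

definition own_info :: "'a measure \<Rightarrow> (nat \<Rightarrow> 'a \<Rightarrow> real) \<Rightarrow> nat \<Rightarrow> 'a measure" where
  "own_info M s i = vimage_algebra (space M) (s i) borel"

definition complete_info :: "'a measure \<Rightarrow> nat set \<Rightarrow> (nat \<Rightarrow> 'a \<Rightarrow> real) \<Rightarrow> 'a measure" where
  "complete_info M J s = vimage_algebra (space M) (profile J s) (profile_space J)"

definition anonymized_info ::
  "'a measure \<Rightarrow> nat set \<Rightarrow> (nat \<Rightarrow> 'a \<Rightarrow> real) \<Rightarrow> ('a \<Rightarrow> nat \<Rightarrow> nat) \<Rightarrow> 'a measure" where
  "anonymized_info M J s \<rho> =
     vimage_algebra (space M) (profile J (\<lambda>j \<omega>. s (\<rho> \<omega> j) \<omega>)) (profile_space J)"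

definition perm_info :: "'a measure \<Rightarrow> nat set \<Rightarrow> ('a \<Rightarrow> nat \<Rightarrow> nat) \<Rightarrow> 'a measure" where
  "perm_info M J \<rho> = vimage_algebra (space M) \<rho> (count_space {p. p permutes J})"

definition independent_info :: "'a measure \<Rightarrow> 'a measure \<Rightarrow> 'a measure \<Rightarrow> bool" where
  "independent_info M F G \<longleftrightarrow> prob_space.indep_set M (sets F) (sets G)"

text \<open>
  Product market. In \<open>quantity\<close>, \<open>profit\<close> and \<open>surplus\<close> the information arguments are first the
  consumer's and then the producer's; \<open>v\<close> is the consumer's willingness to pay.
\<close>

definition price :: "'a measure \<Rightarrow> real \<Rightarrow> ('a \<Rightarrow> real) \<Rightarrow> 'a measure \<Rightarrow> 'a \<Rightarrow> real" where
  "price M c v Y = (\<lambda>\<omega>. (real_cond_exp M Y v \<omega> + c) / 2)"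

definition quantity ::
  "'a measure \<Rightarrow> real \<Rightarrow> ('a \<Rightarrow> real) \<Rightarrow> 'a measure \<Rightarrow> 'a measure \<Rightarrow> 'a \<Rightarrow> real" where
  "quantity M c v F Y = (\<lambda>\<omega>. real_cond_exp M F v \<omega> - price M c v Y \<omega>)"

definition profit ::
  "'a measure \<Rightarrow> real \<Rightarrow> ('a \<Rightarrow> real) \<Rightarrow> 'a measure \<Rightarrow> 'a measure \<Rightarrow> real" where
  "profit M c v F Y = (\<integral>\<omega>. (price M c v Y \<omega> - c) * quantity M c v F Y \<omega> \<partial>M)"

definition surplus ::
  "'a measure \<Rightarrow> real \<Rightarrow> ('a \<Rightarrow> real) \<Rightarrow> 'a measure \<Rightarrow> 'a measure \<Rightarrow> real" where
  "surplus M c v F Y =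
     (\<integral>\<omega>. v \<omega> * quantity M c v F Y \<omega> - price M c v Y \<omega> * quantity M c v F Y \<omega>
           - (quantity M c v F Y \<omega>)\<^sup>2 / 2 \<partial>M)"

text \<open>
  Data market. An inflow policy is given by the information \<open>X\<close> collected when all consumers
  accept, and \<open>Xm i\<close> collected when only consumer \<open>i\<close> refuses.
\<close>

definition producer_payment ::
  "'a measure \<Rightarrow> nat set \<Rightarrow> real \<Rightarrow> (nat \<Rightarrow> 'a \<Rightarrow> real) \<Rightarrow> (nat \<Rightarrow> 'a \<Rightarrow> real) \<Rightarrow>
   'a measure \<Rightarrow> real" where
  "producer_payment M I c w s X =
     (\<Sum>i\<in>I. profit M c (w i) (info_join (own_info M s i) X) X
            - profit M c (w i) (own_info M s i) (no_info M))"

definition consumer_payment ::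
  "'a measure \<Rightarrow> real \<Rightarrow> (nat \<Rightarrow> 'a \<Rightarrow> real) \<Rightarrow> (nat \<Rightarrow> 'a \<Rightarrow> real) \<Rightarrow>
   'a measure \<Rightarrow> (nat \<Rightarrow> 'a measure) \<Rightarrow> nat \<Rightarrow> real" where
  "consumer_payment M c w s X Xm i =
     surplus M c (w i) (info_join (own_info M s i) (Xm i)) (Xm i)
     - surplus M c (w i) (info_join (own_info M s i) X) X"

definition intermediary_profit ::
  "'a measure \<Rightarrow> nat set \<Rightarrow> real \<Rightarrow> (nat \<Rightarrow> 'a \<Rightarrow> real) \<Rightarrow> (nat \<Rightarrow> 'a \<Rightarrow> real) \<Rightarrow>
   'a measure \<Rightarrow> (nat \<Rightarrow> 'a measure) \<Rightarrow> real" where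
  "intermediary_profit M I c w s X Xm =
     producer_payment M I c w s X - (\<Sum>i\<in>I. consumer_payment M c w s X Xm i)"

definition complete_data_profit ::
  "'a measure \<Rightarrow> nat set \<Rightarrow> real \<Rightarrow> (nat \<Rightarrow> 'a \<Rightarrow> real) \<Rightarrow> (nat \<Rightarrow> 'a \<Rightarrow> real) \<Rightarrow> real" where
  "complete_data_profit M I c w s =
     intermediary_profit M I c w s
       (complete_info M I s) (\<lambda>i. complete_info M (I - {i}) s)"

definition anonymized_data_profit ::
  "'a measure \<Rightarrow> nat set \<Rightarrow> real \<Rightarrow> (nat \<Rightarrow> 'a \<Rightarrow> real) \<Rightarrow> (nat \<Rightarrow> 'a \<Rightarrow> real) \<Rightarrow>
   ('a \<Rightarrow> nat \<Rightarrow> nat) \<Rightarrow> (nat \<Rightarrow> 'a \<Rightarrow> nat \<Rightarrow> nat) \<Rightarrow> real" where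
  "anonymized_data_profit M I c w s \<rho> \<rho>m =
     intermediary_profit M I c w s
       (anonymized_info M I s \<rho>) (\<lambda>i. anonymized_info M (I - {i}) s (\<rho>m i))"

end

theory Submission
  imports Defs
begin

text \<open>
  Write \<open>V\<^sub>i(F) = E[E[w\<^sub>i|F]\<^sup>2]\<close>. Profits and surpluses are affine in \<open>V\<^sub>i\<close>, which gives
  \<open>R(A) - R(S) = \<Sum>\<^sub>i (V\<^sub>i(S) - V\<^sub>i(A)) / 8 + 3 (V\<^sub>i(A\<^sub>-\<^sub>i) - V\<^sub>i(S\<^sub>-\<^sub>i)) / 8
  + (V\<^sub>i(S\<^sub>i,A) - V\<^sub>i(S\<^sub>i,A\<^sub>-\<^sub>i)) / 2\<close>, because \<open>(S\<^sub>i,S)\<close> and \<open>(S\<^sub>i,S\<^sub>-\<^sub>i)\<close> carry the same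
  information. Adjoining an independent permutation does not change \<open>V\<^sub>i\<close>, so shuffling never
  increases it. Conversely \<open>E[w\<^sub>i|S]\<close> and \<open>E[w\<^sub>i|S\<^sub>-\<^sub>i]\<close> have versions that are invariant under
  permutations of the signals of the consumers other than \<open>i\<close>, so they can be recovered from
  \<open>(S\<^sub>i,A)\<close> and from \<open>A\<^sub>-\<^sub>i\<close>; hence the last two terms are nonnegative. If the first one vanished
  for all \<open>i\<close>, then \<open>E[w\<^sub>i|S] = E[w\<^sub>i|A]\<close>, which by symmetry does not depend on \<open>i\<close>; testing against
  \<open>s\<^sub>i\<close> would give \<open>E[w\<^sub>i\<^sup>2] = E[w\<^sub>i w\<^sub>j]\<close>, that is, \<open>w\<^sub>i = w\<^sub>j\<close> almost surely.
\<close>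

section \<open>Square integrability, factorization through a map, and joins of
  sigma-algebras\<close>

lemma integrable_mult_square:
  fixes f g :: "'a \<Rightarrow> real"
  assumes [measurable]: "f \<in> borel_measurable M" "g \<in> borel_measurable M"
    and f2: "integrable M (\<lambda>x. (f x)\<^sup>2)" and g2: "integrable M (\<lambda>x. (g x)\<^sup>2)"
  shows "integrable M (\<lambda>x. f x * g x)"
proof (rule Bochner_Integration.integrable_bound)
  show "integrable M (\<lambda>x. (f x)\<^sup>2 + (g x)\<^sup>2)" using f2 g2 by simp
  have "\<bar>a * b\<bar> \<le> a\<^sup>2 + b\<^sup>2" for a b :: real
  proof -
    have "2 * \<bar>a\<bar> * \<bar>b\<bar> \<le> a\<^sup>2 + b\<^sup>2"
      using sum_squares_bound[of "\<bar>a\<bar>" "\<bar>b\<bar>"] by simp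
    moreover have "0 \<le> \<bar>a\<bar> * \<bar>b\<bar>" by simp
    ultimately show ?thesis unfolding abs_mult by linarith
  qed
  then show "AE x in M. norm (f x * g x) \<le> norm ((f x)\<^sup>2 + (g x)\<^sup>2)" by simp
qed simp

text \<open>Doob-Dynkin factorization. It holds for indicators because every set of the vimage
  algebra is a preimage, passes to nonnegative functions through scaling, sums and monotone limits,
  and to \<open>f\<close> by splitting it into positive and negative part.\<close>

lemma vimage_algebra_factorization:
  fixes f :: "'a \<Rightarrow> real"
  assumes T: "T \<in> X \<rightarrow> space N" and f: "f \<in> borel_measurable (vimage_algebra X T N)"
  obtains g where "g \<in> borel_measurable N" "\<And>x. x \<in> X \<Longrightarrow> f x = g (T x)"
proof -
  let ?V = "vimage_algebra X T N"
  have nonneg: "\<exists>g\<in>borel_measurable N. \<forall>x\<in>X. u x = g (T x)"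
    if "u \<in> borel_measurable ?V" "\<And>x. 0 \<le> u x" for u :: "'a \<Rightarrow> real"
    using that
  proof (induction u rule: borel_measurable_induct_real)
    case (set B)
    then obtain C where "C \<in> sets N" "B = T -` C \<inter> X"
      by (auto simp: sets_vimage_algebra2[OF T])
    then show ?case
      by (intro bexI[of _ "indicator C"]) (auto simp: indicator_def)
  next
    case (mult u c)
    then obtain g where "g \<in> borel_measurable N" "\<forall>x\<in>X. u x = g (T x)" by blast
    then show ?case by (intro bexI[of _ "\<lambda>y. c * g y"]) auto
  next
    case (add u v)
    then obtain g h where "g \<in> borel_measurable N" "\<forall>x\<in>X. u x = g (T x)"
      "h \<in> borel_measurable N" "\<forall>x\<in>X. v x = h (T x)" by blast
    then show ?case by (intro bexI[of _ "\<lambda>y. h y + g y"]) auto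
  next
    case (seq U)
    then obtain g where g: "\<And>i. g i \<in> borel_measurable N" "\<And>i x. x \<in> X \<Longrightarrow> U i x = g i (T x)"
      by metis
    show ?case
    proof (intro bexI ballI)
      \<comment> \<open>Outside the image of \<open>T\<close> the sequence \<open>g i y\<close> need
        not converge; \<open>lim\<close> is still measurable, and its value there is irrelevant
        because only points \<open>T x\<close> matter.\<close>
      show "(\<lambda>y. lim (\<lambda>i. g i y)) \<in> borel_measurable N"
        using g(1) by (rule borel_measurable_lim_metric)
      fix x assume "x \<in> X"
      with seq(4)[of x] g(2)[of x] show "u x = lim (\<lambda>i. g i (T x))"
        by (simp add: limI)
    qed
  qed
  obtain g1 where g1: "g1 \<in> borel_measurable N" "\<forall>x\<in>X. max (f x) 0 = g1 (T x)"
    using nonneg[OF borel_measurable_max[OF f borel_measurable_const, of 0]] by fastforce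
  obtain g2 where g2: "g2 \<in> borel_measurable N" "\<forall>x\<in>X. max (- f x) 0 = g2 (T x)"
    using nonneg[OF borel_measurable_max[OF borel_measurable_uminus[OF f] borel_measurable_const, of 0]] by fastforce
  show thesis
  proof
    show "(\<lambda>y. g1 y - g2 y) \<in> borel_measurable N" using g1 g2 by simp
    fix x assume "x \<in> X"
    then have "max (f x) 0 = g1 (T x)" "max (- f x) 0 = g2 (T x)" using g1 g2 by auto
    then show "f x = g1 (T x) - g2 (T x)" by linarith
  qed
qed

lemma subalgebra_vimage_algebra:
  assumes "f \<in> M \<rightarrow>\<^sub>M N"
  shows "subalgebra M (vimage_algebra (space M) f N)"
  using sets_image_in_sets[OF refl assms] by (simp add: subalgebra_def)

lemma
  assumes "subalgebra M F" "subalgebra M G"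
  shows subalgebra_info_join: "subalgebra M (info_join F G)"
    and sets_info_join_upper1: "sets F \<subseteq> sets (info_join F G)"
    and sets_info_join_upper2: "sets G \<subseteq> sets (info_join F G)"
    and sets_info_join_least:
      "subalgebra M K \<Longrightarrow> sets F \<subseteq> sets K \<Longrightarrow> sets G \<subseteq> sets K \<Longrightarrow> sets (info_join F G) \<subseteq> sets K"
proof -
  have sp: "space F = space M" and sub: "sets F \<union> sets G \<subseteq> Pow (space M)"
    using assms sets.space_closed[of M] by (auto simp: subalgebra_def)
  have sets: "sets (info_join F G) = sigma_sets (space M) (sets F \<union> sets G)"
    using sub by (simp add: info_join_def sp)
  have spJ: "space (info_join F G) = space M"
    using sub by (simp add: info_join_def sp space_measure_of)
  show least: "sets (info_join F G) \<subseteq> sets K"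
    if "subalgebra M K" "sets F \<subseteq> sets K" "sets G \<subseteq> sets K" for K
    using that sets.sigma_sets_subset[of "sets F \<union> sets G" K] by (simp add: sets subalgebra_def)
  show "subalgebra M (info_join F G)"
    using assms least[of M] spJ by (simp add: subalgebra_def)
  show "sets F \<subseteq> sets (info_join F G)" "sets G \<subseteq> sets (info_join F G)"
    by (auto simp: sets)
qed

lemma measurable_subalgebra_mono:
  assumes "subalgebra M F" "subalgebra M G" "sets F \<subseteq> sets G" "f \<in> F \<rightarrow>\<^sub>M N"
  shows "f \<in> G \<rightarrow>\<^sub>M N"
  using measurable_from_subalg[of G F f N] assms by (auto simp: subalgebra_def)

lemma sets_vimage_algebra_least:
  assumes "subalgebra M K" "f \<in> K \<rightarrow>\<^sub>M N"
  shows "sets (vimage_algebra (space M) f N) \<subseteq> sets K"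
  using assms sets_image_in_sets[of K "space M" f N] by (simp add: subalgebra_def)

lemma profile_measurable:
  assumes "\<And>j. j \<in> J \<Longrightarrow> x j \<in> borel_measurable N"
  shows "profile J x \<in> N \<rightarrow>\<^sub>M profile_space J"
  unfolding profile_def using assms by (intro measurable_restrict)

lemma measurable_profile_component:
  assumes "j \<in> J" "profile J x \<in> N \<rightarrow>\<^sub>M profile_space J"
  shows "x j \<in> borel_measurable N"
proof -
  have "(\<lambda>\<omega>. profile J x \<omega> j) \<in> borel_measurable N"
    using measurable_compose[OF assms(2) measurable_component_singleton[OF assms(1)]] .
  then show ?thesis using assms(1) by (simp add: profile_def)
qed

lemma measurable_complete_info:
  assumes "j \<in> J"
  shows "x j \<in> borel_measurable (complete_info M J x)"
  unfolding complete_info_def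
  by (rule measurable_profile_component[OF assms measurable_vimage_algebra1])
    (auto simp: profile_def space_PiM)

lemma permute_profile_measurable:
  assumes "p permutes J"
  shows "(\<lambda>x. \<lambda>j\<in>J. x (p j)) \<in> profile_space J \<rightarrow>\<^sub>M profile_space J"
  using permutes_in_image[OF assms]
  by (intro measurable_restrict measurable_component_singleton) auto

text \<open>For integrable \<open>v\<close> on a probability space this differs from the variance of
  the posterior mean only by the constant \<open>(E v)\<^sup>2\<close>, so it ranks information in
  the same way.\<close>

definition info_value :: "'a measure \<Rightarrow> ('a \<Rightarrow> real) \<Rightarrow> 'a measure \<Rightarrow> real" where
  "info_value M v F = (\<integral>\<omega>. (real_cond_exp M F v \<omega>)\<^sup>2 \<partial>M)"

section \<open>Conditional expectation as an L2 projection\<close>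

context prob_space
begin

lemma sigma_finite_subalgebraI:
  assumes "subalgebra M F"
  shows "sigma_finite_subalgebra M F"
proof -
  interpret finite_measure_subalgebra M F
    using assms by unfold_locales (auto simp: subalgebra_def)
  show ?thesis ..
qed

lemma integrable_cond_exp_square:
  assumes "subalgebra M F" "integrable M v" "integrable M (\<lambda>\<omega>. (v \<omega>)\<^sup>2)"
  shows "integrable M (\<lambda>\<omega>. (real_cond_exp M F v \<omega>)\<^sup>2)"
proof -
  interpret sigma_finite_subalgebra M F by (rule sigma_finite_subalgebraI[OF assms(1)])
  show ?thesis
    by (rule integrable_convex_cond_exp[where X = v and I = UNIV and q = "\<lambda>x. x\<^sup>2"])
      (use assms(2,3) convex_power2 in \<open>auto simp: emeasure_space_1\<close>)
qed

text \<open>Orthogonality of the residual \<open>v - E[v|F]\<close> to the square-integrable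
  \<open>F\<close>-measurable functions; square integrability of \<open>v\<close> and
  \<open>g\<close> makes their product integrable.\<close>

lemma cond_exp_inner:
  assumes F: "subalgebra M F" and v: "integrable M v" "integrable M (\<lambda>\<omega>. (v \<omega>)\<^sup>2)"
    and g: "g \<in> borel_measurable F" "integrable M (\<lambda>\<omega>. (g \<omega>)\<^sup>2)"
  shows "(\<integral>\<omega>. real_cond_exp M F v \<omega> * g \<omega> \<partial>M) = (\<integral>\<omega>. v \<omega> * g \<omega> \<partial>M)"
proof -
  interpret sigma_finite_subalgebra M F by (rule sigma_finite_subalgebraI[OF F])
  have gM: "g \<in> borel_measurable M" by (rule measurable_from_subalg[OF F g(1)])
  have "integrable M (\<lambda>\<omega>. g \<omega> * v \<omega>)"
    using gM v g(2) by (intro integrable_mult_square) auto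
  from real_cond_exp_intg(2)[OF this g(1)] v(1) show ?thesis
    by (simp add: mult.commute)
qed

text \<open>A Pythagorean identity for sigma-algebras that need not be nested. Let \<open>a\<close>,
  \<open>b\<close> be the conditional expectations given \<open>F\<close> and \<open>G\<close>.
  Since \<open>b\<close> has an \<open>F\<close>-measurable version \<open>g\<close>, the projection
  onto \<open>F\<close> turns \<open>E[a b]\<close> into \<open>E[v b]\<close>, and the projection
  onto \<open>G\<close> turns this into \<open>E[b\<^sup>2]\<close>.\<close>

lemma cond_exp_dist_square:
  assumes F: "subalgebra M F" and G: "subalgebra M G"
    and v: "integrable M v" "integrable M (\<lambda>\<omega>. (v \<omega>)\<^sup>2)"
    and g: "g \<in> borel_measurable F" and eq: "AE \<omega> in M. real_cond_exp M G v \<omega> = g \<omega>"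
  shows "(\<integral>\<omega>. (real_cond_exp M F v \<omega> - real_cond_exp M G v \<omega>)\<^sup>2 \<partial>M)
    = info_value M v F - info_value M v G"
proof -
  let ?a = "real_cond_exp M F v" and ?b = "real_cond_exp M G v"
  have [measurable]: "g \<in> borel_measurable M" by (rule measurable_from_subalg[OF F g])
  have [measurable]: "?a \<in> borel_measurable M" "?b \<in> borel_measurable M" by auto
  note a2 = integrable_cond_exp_square[OF F v] and b2 = integrable_cond_exp_square[OF G v]
  have "integrable M (\<lambda>\<omega>. (g \<omega>)\<^sup>2) \<longleftrightarrow> integrable M (\<lambda>\<omega>. (?b \<omega>)\<^sup>2)"
    using eq by (intro integrable_cong_AE) auto
  with b2 have g2: "integrable M (\<lambda>\<omega>. (g \<omega>)\<^sup>2)" by simp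
  have "(\<integral>\<omega>. ?a \<omega> * ?b \<omega> \<partial>M) = (\<integral>\<omega>. ?a \<omega> * g \<omega> \<partial>M)"
    using eq by (intro integral_cong_AE) auto
  also have "\<dots> = (\<integral>\<omega>. v \<omega> * g \<omega> \<partial>M)" by (rule cond_exp_inner[OF F v g g2])
  also have "\<dots> = (\<integral>\<omega>. v \<omega> * ?b \<omega> \<partial>M)"
    using eq v by (intro integral_cong_AE) auto
  also have "\<dots> = (\<integral>\<omega>. ?b \<omega> * ?b \<omega> \<partial>M)"
    by (rule cond_exp_inner[OF G v _ b2, symmetric]) simp
  finally have ab: "(\<integral>\<omega>. ?a \<omega> * ?b \<omega> \<partial>M) = info_value M v G"
    by (simp add: info_value_def power2_eq_square)
  have abi: "integrable M (\<lambda>\<omega>. ?a \<omega> * ?b \<omega>)" using a2 b2 by (intro integrable_mult_square) auto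
  have "(\<integral>\<omega>. (?a \<omega> - ?b \<omega>)\<^sup>2 \<partial>M) = (\<integral>\<omega>. (?a \<omega>)\<^sup>2 - 2 * (?a \<omega> * ?b \<omega>) + (?b \<omega>)\<^sup>2 \<partial>M)"
    by (simp add: power2_diff algebra_simps)
  also have "\<dots> = info_value M v F - 2 * info_value M v G + info_value M v G"
    using a2 b2 abi ab by (simp add: info_value_def)
  finally show ?thesis by simp
qed

text \<open>Serves for data and their shuffles, where a version of the conditional expectation can
  be recovered although the sigma-algebra itself cannot.\<close>

lemma info_value_ge_version:
  assumes "subalgebra M F" "subalgebra M G"
    "integrable M v" "integrable M (\<lambda>\<omega>. (v \<omega>)\<^sup>2)"
    "g \<in> borel_measurable F" "AE \<omega> in M. real_cond_exp M G v \<omega> = g \<omega>"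
  shows "info_value M v G \<le> info_value M v F"
proof -
  have "0 \<le> (\<integral>\<omega>. (real_cond_exp M F v \<omega> - real_cond_exp M G v \<omega>)\<^sup>2 \<partial>M)" by simp
  then show ?thesis unfolding cond_exp_dist_square[OF assms] by simp
qed

lemma info_value_mono:
  assumes "subalgebra M F" "subalgebra M G" "sets F \<subseteq> sets G"
    "integrable M v" "integrable M (\<lambda>\<omega>. (v \<omega>)\<^sup>2)"
  shows "info_value M v F \<le> info_value M v G"
    and "info_value M v F = info_value M v G \<Longrightarrow>
      AE \<omega> in M. real_cond_exp M F v \<omega> = real_cond_exp M G v \<omega>"
proof -
  have GF: "subalgebra G F" using assms by (auto simp: subalgebra_def)
  have m: "real_cond_exp M F v \<in> borel_measurable G"
    by (rule measurable_from_subalg[OF GF]) simp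
  show "info_value M v F \<le> info_value M v G"
    by (rule info_value_ge_version[OF assms(2,1,4,5) m]) simp
  assume "info_value M v F = info_value M v G"
  then have 0: "(\<integral>\<omega>. (real_cond_exp M G v \<omega> - real_cond_exp M F v \<omega>)\<^sup>2 \<partial>M) = 0"
    using cond_exp_dist_square[OF assms(2,1,4,5) m] by simp
  \<comment> \<open>A vanishing Bochner integral says nothing about a nonintegrable function, whose
    integral is 0 by default; hence the squared distance is first shown to be integrable.\<close>
  have "integrable M (\<lambda>\<omega>. real_cond_exp M G v \<omega> * real_cond_exp M F v \<omega>)"
    using assms integrable_cond_exp_square by (intro integrable_mult_square) auto
  then have "integrable M (\<lambda>\<omega>. (real_cond_exp M G v \<omega>)\<^sup>2 + (real_cond_exp M F v \<omega>)\<^sup>2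
      - 2 * (real_cond_exp M G v \<omega> * real_cond_exp M F v \<omega>))"
    using assms integrable_cond_exp_square by simp
  then have "integrable M (\<lambda>\<omega>. (real_cond_exp M G v \<omega> - real_cond_exp M F v \<omega>)\<^sup>2)"
    by (simp add: power2_diff mult.assoc)
  from integral_nonneg_eq_0_iff_AE[OF this] 0
  show "AE \<omega> in M. real_cond_exp M F v \<omega> = real_cond_exp M G v \<omega>" by auto
qed

section \<open>Profit and surplus as affine functions of the information value\<close>

lemma profit_eq_info_value:
  assumes F: "subalgebra M F" and Y: "subalgebra M Y" and YF: "sets Y \<subseteq> sets F"
    and v: "integrable M v" "integrable M (\<lambda>\<omega>. (v \<omega>)\<^sup>2)"
  shows "profit M c v F Y = (info_value M v Y - 2 * c * expectation v + c\<^sup>2) / 4"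
proof -
  interpret F: sigma_finite_subalgebra M F by (rule sigma_finite_subalgebraI[OF F])
  let ?a = "real_cond_exp M Y v" and ?b = "real_cond_exp M F v"
  have FY: "subalgebra F Y" using F Y YF by (auto simp: subalgebra_def)
  have aF: "?a \<in> borel_measurable F" by (rule measurable_from_subalg[OF FY]) simp
  note a2 = integrable_cond_exp_square[OF Y v] and b2 = integrable_cond_exp_square[OF F v]
  have abi: "integrable M (\<lambda>\<omega>. ?b \<omega> * ?a \<omega>)" using a2 b2 by (intro integrable_mult_square) auto
  \<comment> \<open>As \<open>Y\<close> is contained in \<open>F\<close>, the function
    \<open>a\<close> is measurable for both, so \<open>E[b a]\<close> and \<open>E[a a]\<close> both
    equal \<open>E[v a]\<close>. This is why the consumer's information drops out of the
    profit.\<close>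
  have ab: "(\<integral>\<omega>. ?b \<omega> * ?a \<omega> \<partial>M) = info_value M v Y"
    using cond_exp_inner[OF F v aF a2] cond_exp_inner[OF Y v _ a2]
    by (simp add: info_value_def power2_eq_square)
  have "profit M c v F Y
      = (\<integral>\<omega>. ?b \<omega> * ?a \<omega> / 2 - c * ?b \<omega> / 2 - (?a \<omega>)\<^sup>2 / 4 + c\<^sup>2 / 4 \<partial>M)"
    unfolding profit_def quantity_def price_def
    by (intro Bochner_Integration.integral_cong) (auto simp: field_simps power2_eq_square)
  also have "\<dots> = info_value M v Y / 2 - c * expectation v / 2 - info_value M v Y / 4 + c\<^sup>2 / 4"
    using abi a2 F.real_cond_exp_int[OF v(1)] ab by (simp add: info_value_def prob_space)
  finally show ?thesis by (simp add: field_simps)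
qed

lemma surplus_eq_info_value:
  assumes F: "subalgebra M F" and Y: "subalgebra M Y"
    and v: "integrable M v" "integrable M (\<lambda>\<omega>. (v \<omega>)\<^sup>2)"
  shows "surplus M c v F Y = info_value M v F / 2 - 3 / 8 * info_value M v Y
    - c * expectation v / 4 + c\<^sup>2 / 8"
proof -
  interpret Y: sigma_finite_subalgebra M Y by (rule sigma_finite_subalgebraI[OF Y])
  let ?a = "real_cond_exp M Y v" and ?b = "real_cond_exp M F v"
  note a2 = integrable_cond_exp_square[OF Y v] and b2 = integrable_cond_exp_square[OF F v]
  have vai: "integrable M (\<lambda>\<omega>. v \<omega> * ?a \<omega>)" and vbi: "integrable M (\<lambda>\<omega>. v \<omega> * ?b \<omega>)"
    using a2 b2 v by (auto intro!: integrable_mult_square)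
  have va: "(\<integral>\<omega>. v \<omega> * ?a \<omega> \<partial>M) = info_value M v Y"
    using cond_exp_inner[OF Y v _ a2] by (simp add: info_value_def power2_eq_square)
  have vb: "(\<integral>\<omega>. v \<omega> * ?b \<omega> \<partial>M) = info_value M v F"
    using cond_exp_inner[OF F v _ b2] by (simp add: info_value_def power2_eq_square)
  \<comment> \<open>With \<open>p\<close> the price, the integrand equals
    \<open>v b - v p - b\<^sup>2 / 2 + p\<^sup>2 / 2\<close>: the products of \<open>a\<close> and
    \<open>b\<close> cancel, and each conditional expectation is paired only with \<open>v\<close>
    or with itself.\<close>
  have "surplus M c v F Y
      = (\<integral>\<omega>. v \<omega> * ?b \<omega> - v \<omega> * ?a \<omega> / 2 - c * v \<omega> / 2 - (?b \<omega>)\<^sup>2 / 2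
          + (?a \<omega>)\<^sup>2 / 8 + c * ?a \<omega> / 4 + c\<^sup>2 / 8 \<partial>M)"
    unfolding surplus_def quantity_def price_def
    by (intro Bochner_Integration.integral_cong) (auto simp: field_simps power2_eq_square)
  also have "\<dots> = info_value M v F - info_value M v Y / 2 - c * expectation v / 2
      - info_value M v F / 2 + info_value M v Y / 8 + c * expectation v / 4 + c\<^sup>2 / 8"
    using vai vbi a2 b2 v Y.real_cond_exp_int[OF v(1)] va vb
    by (simp add: info_value_def prob_space)
  finally show ?thesis by (simp add: field_simps)
qed

section \<open>Adjoining independent information\<close>

lemma indep_set_integral_mult_indicator:
  fixes d :: "'a \<Rightarrow> real"
  assumes H: "subalgebra M H" and ind: "indep_set (sets H) (sets K)"
    and d: "d \<in> borel_measurable H" "integrable M d" and b: "b \<in> sets K"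
  shows "(\<integral>\<omega>. d \<omega> * indicator b \<omega> \<partial>M) = expectation d * prob b"
proof -
  have bM: "b \<in> events" using indep_setD_ev2[OF ind] b by auto
  have dM: "d \<in> borel_measurable M" by (rule measurable_from_subalg[OF H d(1)])
  have "indep_set (sigma_sets (space M) {d -` A \<inter> space M |A. A \<in> sets borel})
      (sigma_sets (space M) {b \<inter> space M})"
  proof (rule indep_set_sigma_sets)
    have "d -` A \<inter> space M \<in> sets H" if "A \<in> sets borel" for A
      using measurable_sets[OF d(1) that] H by (simp add: subalgebra_def)
    then show "indep_set {d -` A \<inter> space M |A. A \<in> sets borel} {b \<inter> space M}"
      unfolding indep_sets2_eq
      using ind[unfolded indep_sets2_eq] b sets.sets_into_space[OF bM]
      by (auto simp: Int_absorb2)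
    show "Int_stable {d -` A \<inter> space M |A. A \<in> sets borel}"
    proof (safe intro!: Int_stableI)
      fix A B :: "real set" assume "A \<in> sets borel" "B \<in> sets borel"
      then show "\<exists>C. d -` A \<inter> space M \<inter> (d -` B \<inter> space M) = d -` C \<inter> space M \<and> C \<in> sets borel"
        by (intro exI[of _ "A \<inter> B"]) auto
    qed
  qed (auto simp: Int_stable_def)
  \<comment> \<open>The variable \<open>indicator b\<close> generates nothing beyond
    \<open>b\<close> and its complement, so independence of sigma-algebras becomes independence of
    two random variables, for which expectations multiply.\<close>
  moreover have "sigma_sets (space M) {(indicator b :: 'a \<Rightarrow> real) -` A \<inter> space M |A. A \<in> sets borel}
      \<subseteq> sigma_sets (space M) {b \<inter> space M}"
  proof (rule sigma_sets_mono, safe)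
    fix A :: "real set"
    have "(indicator b :: 'a \<Rightarrow> real) -` A \<inter> space M =
      (if 1 \<in> A then b \<inter> space M else {}) \<union> (if 0 \<in> A then space M - b \<inter> space M else {})"
      by (rule set_eqI) (auto simp: indicator_def of_bool_def split: if_splits)
    then have "(indicator b :: 'a \<Rightarrow> real) -` A \<inter> space M \<in>
      {{}, space M, b \<inter> space M, space M - b \<inter> space M}"
      by (simp split: if_splits)
    moreover have "space M - b \<inter> space M \<in> sigma_sets (space M) {b \<inter> space M}"
      by (intro sigma_sets.Compl sigma_sets.Basic) simp
    ultimately show "(indicator b :: 'a \<Rightarrow> real) -` A \<inter> space M \<in> sigma_sets (space M) {b \<inter> space M}"
      by (auto intro: sigma_sets.Basic sigma_sets.Empty sigma_sets_top)
  qed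
  ultimately have "indep_var borel d borel (indicator b :: 'a \<Rightarrow> real)"
    unfolding indep_var_eq using dM bM
    by (auto simp: indep_sets2_eq)
  from indep_var_lebesgue_integral[OF this d(2)] bM show ?thesis
    by (simp add: less_top[symmetric])
qed

text \<open>The residual \<open>d = v - E[v|F]\<close> is \<open>H\<close>-measurable and integrates
  to 0 over each \<open>a \<in> sets F\<close>. By independence it integrates to 0 over every
  \<open>a \<inter> b\<close> with \<open>b \<in> sets K\<close>, and a Dynkin argument extends this
  to the join. The larger \<open>H\<close> expresses that \<open>F\<close> and \<open>v\<close> are
  jointly independent of \<open>K\<close>; separate independence would not suffice.\<close>

lemma real_cond_exp_indep_join:
  assumes F: "subalgebra M F" and H: "subalgebra M H" and K: "subalgebra M K"
    and FH: "sets F \<subseteq> sets H" and ind: "indep_set (sets H) (sets K)"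
    and v: "v \<in> borel_measurable H" "integrable M v"
  shows "AE \<omega> in M. real_cond_exp M (info_join F K) v \<omega> = real_cond_exp M F v \<omega>"
proof -
  interpret F: sigma_finite_subalgebra M F by (rule sigma_finite_subalgebraI[OF F])
  let ?h = "real_cond_exp M F v"
  define d where "d = (\<lambda>\<omega>. v \<omega> - ?h \<omega>)"
  have sub: "sets F \<union> sets K \<subseteq> Pow (space M)"
    using F K sets.space_closed[of M] by (auto simp: subalgebra_def)
  have sF: "space F = space M" and sK: "space K = space M" using F K by (auto simp: subalgebra_def)
  have setsFK: "sets (info_join F K) = sigma_sets (space M) (sets F \<union> sets K)"
    using sub by (simp add: info_join_def sF sets_measure_of)
  have J: "subalgebra M (info_join F K)" by (rule subalgebra_info_join[OF F K])
  interpret J: sigma_finite_subalgebra M "info_join F K" by (rule sigma_finite_subalgebraI[OF J])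
  have di: "integrable M d" unfolding d_def using v(2) by (intro Bochner_Integration.integrable_diff F.real_cond_exp_int) auto
  have HF: "subalgebra H F" using F H FH by (auto simp: subalgebra_def)
  have hH: "?h \<in> borel_measurable H" by (rule measurable_from_subalg[OF HF]) simp
  have dH: "d \<in> borel_measurable H" unfolding d_def using v(1) hH by simp
  \<comment> \<open>These rectangles are stable under intersection and, with one side the whole
    space, contain both \<open>F\<close> and \<open>K\<close>; so they are a generating pi-system of
    the join.\<close>
  define E where "E = {a \<inter> b |a b. a \<in> sets F \<and> b \<in> sets K}"
  have EP: "E \<subseteq> Pow (space M)" using sub by (auto simp: E_def)
  have stable: "Int_stable E"
  proof (safe intro!: Int_stableI)
    fix A B assume "A \<in> E" "B \<in> E"
    then obtain a b a' b' where "A = a \<inter> b" "B = a' \<inter> b'"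
      "a \<in> sets F" "b \<in> sets K" "a' \<in> sets F" "b' \<in> sets K" by (auto simp: E_def)
    then show "A \<inter> B \<in> E"
      unfolding E_def by (intro CollectI exI[of _ "a \<inter> a'"] exI[of _ "b \<inter> b'"]) auto
  qed
  have EJ: "sigma_sets (space M) (sets F \<union> sets K) = sigma_sets (space M) E"
  proof (rule sigma_sets_eqI)
    fix a assume a: "a \<in> sets F \<union> sets K"
    then have "a \<in> E"
      unfolding E_def
    proof
      assume "a \<in> sets F"
      then show "a \<in> {a \<inter> b |a b. a \<in> sets F \<and> b \<in> sets K}"
        using sets.sets_into_space[of a F] sF sK sets.top[of K]
        by (intro CollectI exI[of _ a] exI[of _ "space M"]) auto
    next
      assume "a \<in> sets K"
      then show "a \<in> {a \<inter> b |a b. a \<in> sets F \<and> b \<in> sets K}"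
        using sets.sets_into_space[of a K] sF sK sets.top[of F]
        by (intro CollectI exI[of _ "space M"] exI[of _ a]) auto
    qed
    then show "a \<in> sigma_sets (space M) E" by auto
  next
    fix A assume "A \<in> E"
    then obtain a b where "A = a \<inter> b" "a \<in> sets F" "b \<in> sets K" by (auto simp: E_def)
    then show "A \<in> sigma_sets (space M) (sets F \<union> sets K)"
      using sets.Int[of a "info_join F K" b] by (auto simp: setsFK)
  qed
  have EM: "sigma_sets (space M) E \<subseteq> events" using J EJ setsFK by (auto simp: subalgebra_def)
  have zero: "(\<integral>\<omega>\<in>A. d \<omega> \<partial>M) = 0" if "A \<in> sigma_sets (space M) E" for A
    using stable EP that
  proof (induction rule: sigma_sets_induct_disjoint)
    case (basic A)
    then obtain a b where A: "A = a \<inter> b" and a: "a \<in> sets F" and b: "b \<in> sets K"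
      by (auto simp: E_def)
    have aM: "a \<in> events" using a F by (auto simp: subalgebra_def)
    have "(\<integral>\<omega>\<in>A. d \<omega> \<partial>M) = (\<integral>\<omega>. (d \<omega> * indicator a \<omega>) * indicator b \<omega> \<partial>M)"
      unfolding set_lebesgue_integral_def A
      by (intro Bochner_Integration.integral_cong) (auto simp: indicator_def)
    also have "\<dots> = (\<integral>\<omega>. d \<omega> * indicator a \<omega> \<partial>M) * prob b"
    proof (rule indep_set_integral_mult_indicator[OF H ind _ _ b])
      show "(\<lambda>\<omega>. d \<omega> * indicator a \<omega>) \<in> borel_measurable H" using dH a FH by auto
      show "integrable M (\<lambda>\<omega>. d \<omega> * indicator a \<omega>)"
        using aM di by (rule integrable_real_mult_indicator)
    qed
    also have "(\<integral>\<omega>. d \<omega> * indicator a \<omega> \<partial>M)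
        = (\<integral>\<omega>. v \<omega> * indicator a \<omega> \<partial>M) - (\<integral>\<omega>. ?h \<omega> * indicator a \<omega> \<partial>M)"
      unfolding d_def left_diff_distrib using aM v(2) F.real_cond_exp_int[OF v(2)]
      by (intro Bochner_Integration.integral_diff integrable_real_mult_indicator) auto
    also have "\<dots> = 0"
      using F.real_cond_exp_intA[OF v(2) a] by (simp add: set_lebesgue_integral_def mult.commute)
    finally show ?case by simp
  next
    case empty show ?case by (simp add: set_lebesgue_integral_def)
  next
    case (compl A)
    have AM: "A \<in> events" using compl EM by auto
    have sp: "(\<integral>\<omega>. d \<omega> \<partial>M) = 0"
      unfolding d_def using F.real_cond_exp_int[OF v(2)] v(2) by simp
    have "(\<integral>\<omega>\<in>space M - A. d \<omega> \<partial>M) = (\<integral>\<omega>. d \<omega> - indicator A \<omega> *\<^sub>R d \<omega> \<partial>M)"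
      unfolding set_lebesgue_integral_def
      by (intro Bochner_Integration.integral_cong) (auto simp: indicator_def)
    also have "\<dots> = (\<integral>\<omega>. d \<omega> \<partial>M) - (\<integral>\<omega>\<in>A. d \<omega> \<partial>M)"
      unfolding set_lebesgue_integral_def using di AM
      by (intro Bochner_Integration.integral_diff integrable_mult_indicator) auto
    finally show ?case using sp compl by simp
  next
    case (union f)
    have fM: "f i \<in> events" for i using union EM by auto
    have "(\<integral>\<omega>\<in>(\<Union>i. f i). d \<omega> \<partial>M) = (\<Sum>i. \<integral>\<omega>\<in>f i. d \<omega> \<partial>M)"
    proof (rule lebesgue_integral_countable_add)
      show "\<And>i j. i \<noteq> j \<Longrightarrow> f i \<inter> f j = {}" using union by (auto simp: disjoint_family_on_def)
      show "set_integrable M (\<Union>i. f i) d"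
        unfolding set_integrable_def using di fM by (intro integrable_mult_indicator) auto
    qed (use fM in auto)
    with union show ?case by simp
  qed
  show "AE \<omega> in M. real_cond_exp M (info_join F K) v \<omega> = ?h \<omega>"
  proof (rule J.real_cond_exp_charact)
    fix A assume "A \<in> sets (info_join F K)"
    then have A: "A \<in> sigma_sets (space M) E" by (simp add: setsFK EJ)
    then have AM: "A \<in> events" using EM by auto
    have "(\<integral>\<omega>\<in>A. d \<omega> \<partial>M) = (\<integral>\<omega>\<in>A. v \<omega> \<partial>M) - (\<integral>\<omega>\<in>A. ?h \<omega> \<partial>M)"
      unfolding d_def
      using AM v(2) F.real_cond_exp_int[OF v(2)]
      by (intro set_integral_diff) (auto simp: set_integrable_def simp del: real_scaleR_def
        intro!: integrable_mult_indicator)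
    with zero[OF A] show "(\<integral>\<omega>\<in>A. v \<omega> \<partial>M) = (\<integral>\<omega>\<in>A. ?h \<omega> \<partial>M)" by simp
  next
    show "?h \<in> borel_measurable (info_join F K)"
      by (rule measurable_subalgebra_mono[OF F J sets_info_join_upper1[OF F K]]) simp
  qed (use v F.real_cond_exp_int[OF v(2)] in auto)
qed

lemma info_value_indep_join:
  assumes "subalgebra M F" "subalgebra M H" "subalgebra M K"
    "sets F \<subseteq> sets H" "indep_set (sets H) (sets K)" "v \<in> borel_measurable H" "integrable M v"
  shows "info_value M v (info_join F K) = info_value M v F"
  unfolding info_value_def
  using real_cond_exp_indep_join[OF assms] by (intro integral_cong_AE) auto

end

subsection \<open>Exchangeable consumers\<close>

locale symmetric_market = prob_space M for M :: "'a measure" +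
  fixes I :: "nat set" and w e :: "nat \<Rightarrow> 'a \<Rightarrow> real" and \<sigma> :: real
  assumes finite_I: "finite I"
    and w_int: "\<And>i. i \<in> I \<Longrightarrow> integrable M (w i)" "\<And>i. i \<in> I \<Longrightarrow> integrable M (\<lambda>\<omega>. (w i \<omega>)\<^sup>2)"
    and e_int: "\<And>i. i \<in> I \<Longrightarrow> integrable M (e i)" "\<And>i. i \<in> I \<Longrightarrow> integrable M (\<lambda>\<omega>. (e i \<omega>)\<^sup>2)"
    and w_sym: "symmetric_distr M I w" and e_sym: "symmetric_distr M I e"
    and w_e_indep: "independent_info M (complete_info M I w) (complete_info M I e)"
begin

abbreviation s :: "nat \<Rightarrow> 'a \<Rightarrow> real" where
  "s \<equiv> signal \<sigma> w e"

text \<open>All characteristics and errors together. \<open>H\<close> makes every \<open>w i\<close>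
  and every signal measurable, and the shuffling permutations are independent of it, so it takes the
  place of the large sigma-algebra in \<open>info_value_indep_join\<close>.\<close>

abbreviation H :: "'a measure" where
  "H \<equiv> info_join (complete_info M I w) (complete_info M I e)"

lemma w_meas: "i \<in> I \<Longrightarrow> w i \<in> borel_measurable M"
  and e_meas: "i \<in> I \<Longrightarrow> e i \<in> borel_measurable M"
  by (simp_all add: borel_measurable_integrable w_int(1) e_int(1))

lemma s_meas: "i \<in> I \<Longrightarrow> s i \<in> borel_measurable M"
  unfolding signal_def by (intro borel_measurable_add borel_measurable_times w_meas e_meas) auto

lemma s_square_int:
  assumes "i \<in> I"
  shows "integrable M (\<lambda>\<omega>. (s i \<omega>)\<^sup>2)"
proof -
  have "integrable M (\<lambda>\<omega>. w i \<omega> * e i \<omega>)"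
    using assms w_int e_int by (intro integrable_mult_square) auto
  then have "integrable M (\<lambda>\<omega>. (w i \<omega>)\<^sup>2 + 2 * \<sigma> * (w i \<omega> * e i \<omega>) + \<sigma>\<^sup>2 * (e i \<omega>)\<^sup>2)"
    using assms w_int e_int by (intro Bochner_Integration.integrable_add) auto
  then show ?thesis by (simp add: signal_def power2_sum power_mult_distrib algebra_simps)
qed

lemma
  shows subalgebra_w: "subalgebra M (complete_info M I w)"
    and subalgebra_e: "subalgebra M (complete_info M I e)"
  unfolding complete_info_def
  by (simp_all add: subalgebra_vimage_algebra profile_measurable w_meas e_meas)

lemma subalgebra_H: "subalgebra M H"
  by (intro subalgebra_info_join subalgebra_w subalgebra_e)

lemma subalgebra_complete: "J \<subseteq> I \<Longrightarrow> subalgebra M (complete_info M J s)"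
  unfolding complete_info_def
  by (intro subalgebra_vimage_algebra profile_measurable s_meas) auto

lemma subalgebra_own: "i \<in> I \<Longrightarrow> subalgebra M (own_info M s i)"
  unfolding own_info_def by (intro subalgebra_vimage_algebra s_meas)

lemma w_H:
  assumes "i \<in> I"
  shows "w i \<in> borel_measurable H"
  using measurable_complete_info[OF assms]
  by (rule measurable_subalgebra_mono[OF subalgebra_w subalgebra_H
        sets_info_join_upper1[OF subalgebra_w subalgebra_e]])

lemma e_H:
  assumes "i \<in> I"
  shows "e i \<in> borel_measurable H"
  using measurable_complete_info[OF assms]
  by (rule measurable_subalgebra_mono[OF subalgebra_e subalgebra_H
        sets_info_join_upper2[OF subalgebra_w subalgebra_e]])

lemma s_H: "i \<in> I \<Longrightarrow> s i \<in> borel_measurable H"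
  unfolding signal_def by (intro borel_measurable_add borel_measurable_times w_H e_H) auto

lemma complete_sub_H: "J \<subseteq> I \<Longrightarrow> sets (complete_info M J s) \<subseteq> sets H"
  unfolding complete_info_def[of M J]
  by (intro sets_vimage_algebra_least[OF subalgebra_H] profile_measurable s_H) auto

lemma indep_profiles: "indep_var (profile_space I) (profile I w) (profile_space I) (profile I e)"
  unfolding indep_var_eq
proof (intro conjI)
  show "profile I w \<in> M \<rightarrow>\<^sub>M profile_space I" "profile I e \<in> M \<rightarrow>\<^sub>M profile_space I"
    by (simp_all add: profile_measurable w_meas e_meas)
  show "indep_set (sigma_sets (space M) {profile I w -` A \<inter> space M |A. A \<in> sets (profile_space I)})
     (sigma_sets (space M) {profile I e -` A \<inter> space M |A. A \<in> sets (profile_space I)})"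
    using w_e_indep by (simp add: independent_info_def complete_info_def sets_vimage_algebra)
qed

lemma indep_w_e:
  assumes "i \<in> I" "k \<in> I"
  shows "expectation (\<lambda>\<omega>. w i \<omega> * e k \<omega>) = expectation (w i) * expectation (e k)"
proof -
  have "indep_var borel ((\<lambda>x. x i) \<circ> profile I w) borel ((\<lambda>x. x k) \<circ> profile I e)"
    using assms by (intro indep_var_compose[OF indep_profiles] measurable_component_singleton)
  moreover have "(\<lambda>x. x i) \<circ> profile I w = w i" "(\<lambda>x. x k) \<circ> profile I e = e k"
    using assms by (auto simp: profile_def)
  ultimately show ?thesis
    using assms w_int e_int by (intro indep_var_lebesgue_integral) auto
qed

section \<open>Invariance of the joint law under relabelling of consumers\<close>

lemma joint_symmetric:
  assumes p: "p permutes I"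
  shows "distr M (profile_space I \<Otimes>\<^sub>M profile_space I)
      (\<lambda>\<omega>. (profile I (\<lambda>i. w (p i)) \<omega>, profile I (\<lambda>i. e (p i)) \<omega>))
    = distr M (profile_space I \<Otimes>\<^sub>M profile_space I) (\<lambda>\<omega>. (profile I w \<omega>, profile I e \<omega>))"
proof -
  let ?R = "\<lambda>x::nat \<Rightarrow> real. \<lambda>j\<in>I. x (p j)"
  have R: "?R \<circ> profile I x = profile I (\<lambda>i. x (p i))" for x :: "nat \<Rightarrow> 'a \<Rightarrow> real"
    using permutes_in_image[OF p] by (auto simp: profile_def fun_eq_iff)
  \<comment> \<open>Relabelling both vectors by the same \<open>p\<close> preserves their
    independence and each marginal law, so both joint laws are the same product measure.\<close>
  have "indep_var (profile_space I) (profile I (\<lambda>i. w (p i)))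
      (profile_space I) (profile I (\<lambda>i. e (p i)))"
    using indep_var_compose[OF indep_profiles permute_profile_measurable[OF p]
        permute_profile_measurable[OF p]] unfolding R .
  moreover have "distr M (profile_space I) (profile I (\<lambda>i. w (p i))) = distr M (profile_space I) (profile I w)"
    "distr M (profile_space I) (profile I (\<lambda>i. e (p i))) = distr M (profile_space I) (profile I e)"
    using w_sym e_sym p by (simp_all add: symmetric_distr_def)
  ultimately show ?thesis
    using indep_profiles unfolding indep_var_distribution_eq by simp
qed

lemma law_symmetric:
  assumes p: "p permutes I" and i: "i \<in> I" and J: "J \<subseteq> I"
  shows "distr M (borel \<Otimes>\<^sub>M profile_space J) (\<lambda>\<omega>. (w (p i) \<omega>, profile J (\<lambda>j. s (p j)) \<omega>))
    = distr M (borel \<Otimes>\<^sub>M profile_space J) (\<lambda>\<omega>. (w i \<omega>, profile J s \<omega>))"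
proof -
  let ?P = "profile_space I"
  \<comment> \<open>The selected willingness to pay and the signals are one fixed measurable
    function of the two vectors, so equality of laws carries over; applied to relabelled vectors it
    yields \<open>w (p i)\<close> and \<open>s (p j)\<close>.\<close>
  define f where "f = (\<lambda>xy :: (nat \<Rightarrow> real) \<times> (nat \<Rightarrow> real).
    (fst xy i, \<lambda>j\<in>J. fst xy j + \<sigma> * snd xy j))"
  have c: "(\<lambda>x. x j) \<in> borel_measurable ?P" if "j \<in> I" for j
    using that by (rule measurable_component_singleton)
  have f1: "(\<lambda>xy. fst xy j) \<in> borel_measurable (?P \<Otimes>\<^sub>M ?P)"
    and f2: "(\<lambda>xy. snd xy j) \<in> borel_measurable (?P \<Otimes>\<^sub>M ?P)" if "j \<in> I" for j
    using measurable_compose[OF measurable_fst c[OF that]]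
      measurable_compose[OF measurable_snd c[OF that]] by auto
  have f: "f \<in> ?P \<Otimes>\<^sub>M ?P \<rightarrow>\<^sub>M borel \<Otimes>\<^sub>M profile_space J"
    unfolding f_def using f1 f2 i J
    by (intro measurable_Pair measurable_restrict borel_measurable_add borel_measurable_times) auto
  have pI: "p j \<in> I" if "j \<in> I" for j using that permutes_in_image[OF p] by simp
  have m: "(\<lambda>\<omega>. (profile I x \<omega>, profile I y \<omega>)) \<in> M \<rightarrow>\<^sub>M ?P \<Otimes>\<^sub>M ?P"
    if "\<And>j. j \<in> I \<Longrightarrow> x j \<in> borel_measurable M" "\<And>j. j \<in> I \<Longrightarrow> y j \<in> borel_measurable M"
    for x y using that by (intro measurable_Pair profile_measurable)
  have 1: "f \<circ> (\<lambda>\<omega>. (profile I (\<lambda>i. w (p i)) \<omega>, profile I (\<lambda>i. e (p i)) \<omega>))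
      = (\<lambda>\<omega>. (w (p i) \<omega>, profile J (\<lambda>j. s (p j)) \<omega>))"
    and 2: "f \<circ> (\<lambda>\<omega>. (profile I w \<omega>, profile I e \<omega>)) = (\<lambda>\<omega>. (w i \<omega>, profile J s \<omega>))"
    using i J by (auto simp: f_def profile_def signal_def fun_eq_iff)
  show ?thesis
    using distr_distr[OF f m[of "\<lambda>i. w (p i)" "\<lambda>i. e (p i)"]] distr_distr[OF f m[of w e]]
      joint_symmetric[OF p] w_meas e_meas pI
    unfolding 1 2 by simp
qed

lemma measurable_law:
  assumes "i \<in> I" "\<And>j. j \<in> J \<Longrightarrow> p j \<in> I"
  shows "(\<lambda>\<omega>. (w i \<omega>, profile J (\<lambda>j. s (p j)) \<omega>)) \<in> M \<rightarrow>\<^sub>M borel \<Otimes>\<^sub>M profile_space J"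
  using assms by (intro measurable_Pair w_meas profile_measurable s_meas)

lemma
  fixes \<Phi> :: "real \<times> (nat \<Rightarrow> real) \<Rightarrow> real"
  assumes p: "p permutes I" and i: "i \<in> I" and J: "J \<subseteq> I"
    and \<Phi>: "\<Phi> \<in> borel_measurable (borel \<Otimes>\<^sub>M profile_space J)"
  shows integral_symmetric: "(\<integral>\<omega>. \<Phi> (w (p i) \<omega>, profile J (\<lambda>j. s (p j)) \<omega>) \<partial>M)
      = (\<integral>\<omega>. \<Phi> (w i \<omega>, profile J s \<omega>) \<partial>M)"
    and integrable_symmetric: "integrable M (\<lambda>\<omega>. \<Phi> (w (p i) \<omega>, profile J (\<lambda>j. s (p j)) \<omega>))
      \<longleftrightarrow> integrable M (\<lambda>\<omega>. \<Phi> (w i \<omega>, profile J s \<omega>))"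
proof -
  have pI: "p j \<in> I" if "j \<in> I" for j using that permutes_in_image[OF p] by simp
  have m: "(\<lambda>\<omega>. (w (p i) \<omega>, profile J (\<lambda>j. s (p j)) \<omega>)) \<in> M \<rightarrow>\<^sub>M borel \<Otimes>\<^sub>M profile_space J"
    "(\<lambda>\<omega>. (w i \<omega>, profile J s \<omega>)) \<in> M \<rightarrow>\<^sub>M borel \<Otimes>\<^sub>M profile_space J"
    using measurable_law[of "p i" J p] measurable_law[of i J "\<lambda>j. j"] pI i J by auto
  note eq = law_symmetric[OF p i J]
  show "(\<integral>\<omega>. \<Phi> (w (p i) \<omega>, profile J (\<lambda>j. s (p j)) \<omega>) \<partial>M)
      = (\<integral>\<omega>. \<Phi> (w i \<omega>, profile J s \<omega>) \<partial>M)"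
    using integral_distr[OF m(1) \<Phi>] integral_distr[OF m(2) \<Phi>] eq by simp
  show "integrable M (\<lambda>\<omega>. \<Phi> (w (p i) \<omega>, profile J (\<lambda>j. s (p j)) \<omega>))
      \<longleftrightarrow> integrable M (\<lambda>\<omega>. \<Phi> (w i \<omega>, profile J s \<omega>))"
    using integrable_distr_eq[OF m(1) \<Phi>] integrable_distr_eq[OF m(2) \<Phi>] eq by simp
qed

lemma expectation_exchange:
  fixes f :: "real \<Rightarrow> real"
  assumes "i \<in> I" "j \<in> I" "f \<in> borel_measurable borel"
  shows "expectation (\<lambda>\<omega>. f (w j \<omega>)) = expectation (\<lambda>\<omega>. f (w i \<omega>))"
  using integral_symmetric[OF permutes_swap_id[OF assms(1,2)] assms(1) subset_refl
      measurable_compose[OF measurable_fst assms(3)]]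
  by simp

section \<open>Conditional expectations as symmetric functions of the signals\<close>

lemma cond_exp_complete_info_charact:
  assumes i: "i \<in> I" and J: "J \<subseteq> I"
    and h: "integrable M h" "h \<in> borel_measurable (complete_info M J s)"
    and eq: "\<And>B. B \<in> sets (profile_space J) \<Longrightarrow>
      (\<integral>\<omega>. w i \<omega> * indicator B (profile J s \<omega>) \<partial>M) = (\<integral>\<omega>. h \<omega> * indicator B (profile J s \<omega>) \<partial>M)"
  shows "AE \<omega> in M. real_cond_exp M (complete_info M J s) (w i) \<omega> = h \<omega>"
proof -
  interpret sigma_finite_subalgebra M "complete_info M J s"
    by (rule sigma_finite_subalgebraI[OF subalgebra_complete[OF J]])
  show ?thesis
  proof (rule real_cond_exp_charact[OF _ w_int(1)[OF i] h])
    fix A assume "A \<in> sets (complete_info M J s)"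
    moreover have "profile J s \<in> space M \<rightarrow> space (profile_space J)"
      by (auto simp: profile_def space_PiM)
    ultimately obtain B where B: "B \<in> sets (profile_space J)" "A = profile J s -` B \<inter> space M"
      by (auto simp: complete_info_def sets_vimage_algebra2)
    have "(\<integral>\<omega>\<in>A. f \<omega> \<partial>M) = (\<integral>\<omega>. f \<omega> * indicator B (profile J s \<omega>) \<partial>M)" for f :: "'a \<Rightarrow> real"
      unfolding set_lebesgue_integral_def B(2)
      by (intro Bochner_Integration.integral_cong) (auto simp: indicator_def)
    then show "(\<integral>\<omega>\<in>A. w i \<omega> \<partial>M) = (\<integral>\<omega>\<in>A. h \<omega> \<partial>M)" using eq[OF B(1)] by simp
  qed
qed

text \<open>A factor \<open>g0\<close> of the conditional expectation is averaged over the finite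
  group of permutations of \<open>J - {i}\<close>. These fix \<open>i\<close>, so by exchangeability
  each permuted copy of \<open>g0\<close> is again a version, and the average is invariant at every
  point, not just almost surely. Working with \<open>J - {i}\<close> covers the case
  \<open>i \<in> J\<close> and the case \<open>i \<notin> J\<close> at once.\<close>

lemma invariant_version:
  assumes i: "i \<in> I" and J: "J \<subseteq> I"
  obtains g where "g \<in> borel_measurable (profile_space J)"
    "AE \<omega> in M. real_cond_exp M (complete_info M J s) (w i) \<omega> = g (profile J s \<omega>)"
    "\<And>q x. q permutes J - {i} \<Longrightarrow> g (\<lambda>j\<in>J. x (q j)) = g (\<lambda>j\<in>J. x j)"
proof -
  let ?F = "complete_info M J s" and ?P = "profile_space J"
  let ?h = "real_cond_exp M ?F (w i)"
  interpret sigma_finite_subalgebra M ?F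
    by (rule sigma_finite_subalgebraI[OF subalgebra_complete[OF J]])
  have S: "profile J s \<in> space M \<rightarrow> space ?P" by (auto simp: profile_def space_PiM)
  have SF: "profile J s \<in> ?F \<rightarrow>\<^sub>M ?P"
    unfolding complete_info_def by (rule measurable_vimage_algebra1[OF S])
  have "?h \<in> borel_measurable ?F" by simp
  then obtain g0 where g0: "g0 \<in> borel_measurable ?P"
    and hg0: "\<And>\<omega>. \<omega> \<in> space M \<Longrightarrow> ?h \<omega> = g0 (profile J s \<omega>)"
    unfolding complete_info_def using vimage_algebra_factorization[OF S] by metis
  define Q where "Q = {q. q permutes J - {i}}"
  have finQ: "finite Q" unfolding Q_def
    using finite_permutations finite_subset[OF J finite_I] by blast
  have idQ: "id \<in> Q" by (simp add: Q_def permutes_id)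
  have QJ: "q permutes J" and QI: "q permutes I" and Qi: "q i = i" if "q \<in> Q" for q
  proof -
    have q: "q permutes J - {i}" using that by (simp add: Q_def)
    show "q permutes J" by (rule permutes_subset[OF q]) auto
    show "q permutes I" by (rule permutes_subset[OF q]) (use J in auto)
    show "q i = i" by (rule permutes_not_in[OF q]) simp
  qed
  have version: "AE \<omega> in M. ?h \<omega> = g0 (profile J (\<lambda>j. s (q j)) \<omega>)" if "q \<in> Q" for q
  proof (rule cond_exp_complete_info_charact[OF i J])
    note q = QJ[OF that] QI[OF that] Qi[OF that]
    have perm: "profile J (\<lambda>j. s (q j)) \<omega> = (\<lambda>j\<in>J. profile J s \<omega> (q j))" for \<omega>
      using permutes_in_image[OF q(1)] by (auto simp: profile_def fun_eq_iff)
    have "integrable M (\<lambda>\<omega>. g0 (profile J s \<omega>)) \<longleftrightarrow> integrable M ?h"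
      by (rule Bochner_Integration.integrable_cong) (simp_all add: hg0)
    then have int0: "integrable M (\<lambda>\<omega>. g0 (profile J s \<omega>))"
      using real_cond_exp_int(1)[OF w_int(1)[OF i]] by simp
    have m2: "(\<lambda>xy. f (snd xy)) \<in> borel_measurable (borel \<Otimes>\<^sub>M ?P)"
      if "f \<in> borel_measurable ?P" for f :: "(nat \<Rightarrow> real) \<Rightarrow> real"
      using that by (rule measurable_compose[OF measurable_snd])
    show "integrable M (\<lambda>\<omega>. g0 (profile J (\<lambda>j. s (q j)) \<omega>))"
      using integrable_symmetric[OF q(2) i J m2[OF g0]] int0 by simp
    show "(\<lambda>\<omega>. g0 (profile J (\<lambda>j. s (q j)) \<omega>)) \<in> borel_measurable ?F"
      unfolding perm
      by (rule measurable_compose[OF SF measurable_compose[OF permute_profile_measurable[OF q(1)] g0]])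
    fix B assume B: "B \<in> sets ?P"
    \<comment> \<open>\<open>\<psi>\<close> undoes \<open>q\<close>: evaluated at the signals
      permuted by \<open>q\<close>, it is the test indicator of the unpermuted ones. Exchangeability
      then removes \<open>q\<close>, the projection replaces \<open>w i\<close> by
      \<open>g0\<close>, and exchangeability puts \<open>q\<close> back.\<close>
    define \<psi> where "\<psi> = (\<lambda>x. indicator B (\<lambda>j\<in>J. x (inv q j)) :: real)"
    have \<psi>: "\<psi> \<in> borel_measurable ?P"
      unfolding \<psi>_def using B
      by (intro measurable_compose[OF permute_profile_measurable[OF permutes_inv[OF q(1)]]]
          borel_measurable_indicator)
    have \<psi>q: "\<psi> (profile J (\<lambda>j. s (q j)) \<omega>) = indicator B (profile J s \<omega>)" for \<omega>
    proof -
      have "(\<lambda>j\<in>J. profile J (\<lambda>j. s (q j)) \<omega> (inv q j)) = profile J s \<omega>"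
        using permutes_in_image[OF permutes_inv[OF q(1)]] permutes_inverses(1)[OF q(1)]
        by (auto simp: profile_def fun_eq_iff)
      then show ?thesis by (simp add: \<psi>_def)
    qed
    have "(\<integral>\<omega>. w i \<omega> * indicator B (profile J s \<omega>) \<partial>M)
        = (\<integral>\<omega>. w (q i) \<omega> * \<psi> (profile J (\<lambda>j. s (q j)) \<omega>) \<partial>M)" by (simp add: \<psi>q q(3))
    also have "\<dots> = (\<integral>\<omega>. w i \<omega> * \<psi> (profile J s \<omega>) \<partial>M)"
      using integral_symmetric[OF q(2) i J borel_measurable_times[OF measurable_fst m2[OF \<psi>]]]
      by simp
    also have "\<dots> = (\<integral>\<omega>. \<psi> (profile J s \<omega>) * ?h \<omega> \<partial>M)"
    proof (subst mult.commute, rule real_cond_exp_intg(2)[symmetric])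
      show \<psi>F: "(\<lambda>\<omega>. \<psi> (profile J s \<omega>)) \<in> borel_measurable ?F"
        by (rule measurable_compose[OF SF \<psi>])
      have "(\<lambda>\<omega>. \<psi> (profile J s \<omega>)) \<in> borel_measurable M"
        by (rule measurable_from_subalg[OF subalg \<psi>F])
      then show "integrable M (\<lambda>\<omega>. \<psi> (profile J s \<omega>) * w i \<omega>)"
        using w_int(1)[OF i]
        by (intro Bochner_Integration.integrable_bound[OF w_int(1)[OF i]])
          (auto simp: \<psi>_def indicator_def)
    qed (rule w_meas[OF i])
    also have "\<dots> = (\<integral>\<omega>. \<psi> (profile J s \<omega>) * g0 (profile J s \<omega>) \<partial>M)"
      by (intro Bochner_Integration.integral_cong) (auto simp: hg0)
    also have "\<dots> = (\<integral>\<omega>. \<psi> (profile J (\<lambda>j. s (q j)) \<omega>) * g0 (profile J (\<lambda>j. s (q j)) \<omega>) \<partial>M)"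
      using integral_symmetric[OF q(2) i J borel_measurable_times[OF m2[OF \<psi>] m2[OF g0]]] by simp
    finally show "(\<integral>\<omega>. w i \<omega> * indicator B (profile J s \<omega>) \<partial>M)
        = (\<integral>\<omega>. g0 (profile J (\<lambda>j. s (q j)) \<omega>) * indicator B (profile J s \<omega>) \<partial>M)"
      by (simp add: \<psi>q mult.commute)
  qed
  define g where "g = (\<lambda>x. (\<Sum>q\<in>Q. g0 (\<lambda>j\<in>J. x (q j))) / real (card Q))"
  show thesis
  proof
    show "g \<in> borel_measurable ?P"
      unfolding g_def using QJ
      by (intro borel_measurable_divide borel_measurable_sum
          measurable_compose[OF permute_profile_measurable g0]) auto
    have "AE \<omega> in M. \<forall>q\<in>Q. ?h \<omega> = g0 (profile J (\<lambda>j. s (q j)) \<omega>)"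
      using version finQ by (simp add: AE_finite_all)
    then show "AE \<omega> in M. ?h \<omega> = g (profile J s \<omega>)"
    proof eventually_elim
      case (elim \<omega>)
      have "(\<Sum>q\<in>Q. g0 (\<lambda>j\<in>J. profile J s \<omega> (q j))) = (\<Sum>q\<in>Q. ?h \<omega>)"
      proof (rule sum.cong[OF refl])
        fix q assume q: "q \<in> Q"
        have "(\<lambda>j\<in>J. profile J s \<omega> (q j)) = profile J (\<lambda>j. s (q j)) \<omega>"
          using permutes_in_image[OF QJ[OF q]] by (auto simp: profile_def fun_eq_iff)
        then show "g0 (\<lambda>j\<in>J. profile J s \<omega> (q j)) = ?h \<omega>" using elim q by simp
      qed
      moreover have "card Q \<noteq> 0" using finQ idQ by auto
      ultimately show ?case by (simp add: g_def)
    qed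
  next
    fix q and x :: "nat \<Rightarrow> real" assume q: "q permutes J - {i}"
    have "g (\<lambda>j\<in>J. x (q j)) = (\<Sum>r\<in>Q. g0 (\<lambda>j\<in>J. x ((q \<circ> r) j))) / real (card Q)"
    proof -
      have "(\<lambda>j\<in>J. (\<lambda>j\<in>J. x (q j)) (r j)) = (\<lambda>j\<in>J. x ((q \<circ> r) j))" if "r \<in> Q" for r
        using permutes_in_image[OF QJ[OF that]] by (auto simp: fun_eq_iff)
      then show ?thesis by (simp add: g_def cong: sum.cong)
    qed
    also have "(\<Sum>r\<in>Q. g0 (\<lambda>j\<in>J. x ((q \<circ> r) j))) = (\<Sum>r\<in>Q. g0 (\<lambda>j\<in>J. x (r j)))"
      unfolding Q_def by (rule setum_permutations_compose_left[OF q, symmetric])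
    also have "\<dots> / real (card Q) = g (\<lambda>j\<in>J. x j)"
    proof -
      have "(\<lambda>j\<in>J. (\<lambda>j\<in>J. x j) (r j)) = (\<lambda>j\<in>J. x (r j))" if "r \<in> Q" for r
        using permutes_in_image[OF QJ[OF that]] by (auto simp: fun_eq_iff)
      then show ?thesis by (simp add: g_def cong: sum.cong)
    qed
    finally show "g (\<lambda>j\<in>J. x (q j)) = g (\<lambda>j\<in>J. x j)" .
  qed
qed

section \<open>Randomly permuted signals as information\<close>

lemma measurable_permuted:
  assumes J: "J \<subseteq> I" and \<rho>: "\<rho> \<in> K \<rightarrow>\<^sub>M count_space {p. p permutes J}"
    and s: "\<And>j. j \<in> J \<Longrightarrow> s j \<in> borel_measurable K"
  shows "profile J (\<lambda>j \<omega>. s (\<rho> \<omega> j) \<omega>) \<in> K \<rightarrow>\<^sub>M profile_space J"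
proof (rule profile_measurable)
  fix j assume j: "j \<in> J"
  have fin: "finite {p. p permutes J}" using finite_subset[OF J finite_I] by (rule finite_permutations)
  \<comment> \<open>The index is random, but \<open>\<rho>\<close> has only finitely many values, so
    the function is glued from the measurable functions \<open>s (p j)\<close>.\<close>
  show "(\<lambda>\<omega>. s (\<rho> \<omega> j) \<omega>) \<in> borel_measurable K"
    by (rule measurable_compose_countable'[OF _ \<rho> countable_finite[OF fin], of "\<lambda>p. s (p j)"])
      (use j s permutes_in_image in fastforce)
qed

context
  fixes J :: "nat set" and \<rho> :: "'a \<Rightarrow> nat \<Rightarrow> nat"
  assumes J: "J \<subseteq> I" and \<rho>: "\<rho> \<in> M \<rightarrow>\<^sub>M count_space {p. p permutes J}"
begin

lemma permutes_rho: "\<omega> \<in> space M \<Longrightarrow> \<rho> \<omega> permutes J"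
  using measurable_space[OF \<rho>] by auto

lemma subalgebra_anonymized: "subalgebra M (anonymized_info M J s \<rho>)"
  unfolding anonymized_info_def
  by (rule subalgebra_vimage_algebra[OF measurable_permuted[OF J \<rho> s_meas]]) (use J in auto)

lemma subalgebra_perm: "subalgebra M (perm_info M J \<rho>)"
  unfolding perm_info_def by (rule subalgebra_vimage_algebra[OF \<rho>])

lemma measurable_anonymized:
  "profile J (\<lambda>j \<omega>. s (\<rho> \<omega> j) \<omega>) \<in> anonymized_info M J s \<rho> \<rightarrow>\<^sub>M profile_space J"
  unfolding anonymized_info_def
  by (rule measurable_vimage_algebra1) (auto simp: profile_def space_PiM)

text \<open>A shuffled sample is a function of the signals and the permutation. A set
  \<open>L\<close> larger than \<open>J\<close> allows the shuffle of the others' signals to be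
  compared with the complete sample.\<close>

lemma sets_anonymized_subset:
  assumes L: "J \<subseteq> L" "L \<subseteq> I"
  shows "sets (anonymized_info M J s \<rho>) \<subseteq> sets (info_join (complete_info M L s) (perm_info M J \<rho>))"
proof -
  let ?K = "info_join (complete_info M L s) (perm_info M J \<rho>)"
  note sub = subalgebra_complete[OF L(2)] subalgebra_perm
  have K: "subalgebra M ?K" by (rule subalgebra_info_join[OF sub])
  have "\<rho> \<in> perm_info M J \<rho> \<rightarrow>\<^sub>M count_space {p. p permutes J}"
    unfolding perm_info_def by (rule measurable_vimage_algebra1) (use permutes_rho in auto)
  then have \<rho>K: "\<rho> \<in> ?K \<rightarrow>\<^sub>M count_space {p. p permutes J}"
    by (rule measurable_subalgebra_mono[OF sub(2) K sets_info_join_upper2[OF sub]])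
  have "s j \<in> borel_measurable ?K" if "j \<in> J" for j
    by (rule measurable_subalgebra_mono[OF sub(1) K sets_info_join_upper1[OF sub]
          measurable_complete_info]) (use that L in auto)
  then show ?thesis
    unfolding anonymized_info_def
    by (intro sets_vimage_algebra_least[OF K] measurable_permuted[OF J \<rho>K])
qed

text \<open>How data were shuffled says nothing about \<open>w i\<close>. Together with
  \<open>sets_anonymized_subset\<close> this bounds the value of shuffled data by that of complete
  data.\<close>

lemma info_value_perm_join:
  assumes "independent_info M H (perm_info M J \<rho>)" "L \<subseteq> I" "i \<in> I"
  shows "info_value M (w i) (info_join (complete_info M L s) (perm_info M J \<rho>))
    = info_value M (w i) (complete_info M L s)"
  using assms
  by (intro info_value_indep_join[OF subalgebra_complete subalgebra_H subalgebra_perm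
        complete_sub_H _ w_H w_int(1)]) (auto simp: independent_info_def)

end

subsection \<open>Anonymized and complete data\<close>

text \<open>For a consumer outside \<open>J\<close> the signals in \<open>J\<close> are
  interchangeable, so the posterior mean of \<open>w i\<close> is a symmetric function of them, and
  the shuffled list determines it.\<close>

lemma info_value_anonymized_others:
  assumes i: "i \<in> I" "i \<notin> J" and J: "J \<subseteq> I"
    and \<rho>: "\<rho> \<in> M \<rightarrow>\<^sub>M count_space {p. p permutes J}"
  shows "info_value M (w i) (complete_info M J s) \<le> info_value M (w i) (anonymized_info M J s \<rho>)"
proof -
  obtain g where g: "g \<in> borel_measurable (profile_space J)"
    "AE \<omega> in M. real_cond_exp M (complete_info M J s) (w i) \<omega> = g (profile J s \<omega>)"
    "\<And>q x. q permutes J - {i} \<Longrightarrow> g (\<lambda>j\<in>J. x (q j)) = g (\<lambda>j\<in>J. x j)"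
    using invariant_version[OF i(1) J] by blast
  have "J - {i} = J" using i(2) by simp
  then have eq: "g (profile J (\<lambda>j \<omega>. s (\<rho> \<omega> j) \<omega>) \<omega>) = g (profile J s \<omega>)" if "\<omega> \<in> space M" for \<omega>
    using g(3)[of "\<rho> \<omega>" "\<lambda>j. s j \<omega>"] permutes_rho[OF J \<rho> that] by (simp add: profile_def)
  show ?thesis
  proof (rule info_value_ge_version[OF subalgebra_anonymized[OF J \<rho>] subalgebra_complete[OF J]
        w_int(1)[OF i(1)] w_int(2)[OF i(1)]])
    show "(\<lambda>\<omega>. g (profile J (\<lambda>j \<omega>. s (\<rho> \<omega> j) \<omega>) \<omega>)) \<in> borel_measurable (anonymized_info M J s \<rho>)"
      by (rule measurable_compose[OF measurable_anonymized[OF J \<rho>] g(1)])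
    show "AE \<omega> in M. real_cond_exp M (complete_info M J s) (w i) \<omega>
        = g (profile J (\<lambda>j \<omega>. s (\<rho> \<omega> j) \<omega>) \<omega>)"
      using g(2) AE_space by eventually_elim (simp add: eq)
  qed
qed

text \<open>The posterior mean given all signals is symmetric in the signals other than
  \<open>s i\<close>. The own signal tells which entry of the shuffled sample to single out, and the
  rest is needed only up to order.\<close>

lemma info_value_own_anonymized:
  assumes i: "i \<in> I" and \<rho>: "\<rho> \<in> M \<rightarrow>\<^sub>M count_space {p. p permutes I}"
  shows "info_value M (w i) (complete_info M I s)
    \<le> info_value M (w i) (info_join (own_info M s i) (anonymized_info M I s \<rho>))"
proof -
  let ?K = "info_join (own_info M s i) (anonymized_info M I s \<rho>)"
  define A where "A = (\<lambda>j \<omega>. s (\<rho> \<omega> j) \<omega>)"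
  let ?t = "\<lambda>j. Transposition.transpose j i"
  obtain g where g: "g \<in> borel_measurable (profile_space I)"
    "AE \<omega> in M. real_cond_exp M (complete_info M I s) (w i) \<omega> = g (profile I s \<omega>)"
    "\<And>q x. q permutes I - {i} \<Longrightarrow> g (\<lambda>j\<in>I. x (q j)) = g (\<lambda>j\<in>I. x j)"
    using invariant_version[OF i subset_refl] by blast
  note sub = subalgebra_own[OF i] subalgebra_anonymized[OF subset_refl \<rho>]
  have K: "subalgebra M ?K" by (rule subalgebra_info_join[OF sub])
  txt \<open>
    Swapping \<open>s\<^sub>i\<close> into position \<open>i\<close> of the shuffled signals leaves only a shuffle of the others.
    Ties can make the position of \<open>s\<^sub>i\<close> ambiguous; averaging over all candidates keeps \<open>G\<close> measurable.
  \<close>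
  define count where "count = (\<lambda>\<omega>. \<Sum>j\<in>I. if A j \<omega> = s i \<omega> then 1 else 0 :: real)"
  define G where
    "G = (\<lambda>\<omega>. (\<Sum>j\<in>I. if A j \<omega> = s i \<omega> then g (profile I (\<lambda>k. A (?t j k)) \<omega>) else 0) / count \<omega>)"
  have siK: "s i \<in> borel_measurable ?K"
    by (rule measurable_subalgebra_mono[OF sub(1) K sets_info_join_upper1[OF sub]])
      (simp add: own_info_def measurable_vimage_algebra1)
  have AK: "A j \<in> borel_measurable ?K" if "j \<in> I" for j
  proof -
    have "profile I A \<in> anonymized_info M I s \<rho> \<rightarrow>\<^sub>M profile_space I"
      unfolding A_def by (rule measurable_anonymized[OF subset_refl \<rho>])
    from measurable_profile_component[OF that this] show ?thesis
      by (rule measurable_subalgebra_mono[OF sub(2) K sets_info_join_upper2[OF sub]])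
  qed
  have tI: "?t j permutes I" if "j \<in> I" for j using permutes_swap_id[OF that i] .
  have gK: "(\<lambda>\<omega>. g (profile I (\<lambda>k. A (?t j k)) \<omega>)) \<in> borel_measurable ?K" if "j \<in> I" for j
    by (intro measurable_compose[OF profile_measurable g(1)] AK)
      (use permutes_in_image[OF tI[OF that]] in simp)
  have eqK: "{\<omega> \<in> space ?K. A j \<omega> = s i \<omega>} \<in> sets ?K" if "j \<in> I" for j
    using AK[OF that] siK by measurable
  have GK: "G \<in> borel_measurable ?K"
    unfolding G_def count_def using gK eqK
    by (intro borel_measurable_divide borel_measurable_sum measurable_If) auto
  have Gg: "G \<omega> = g (profile I s \<omega>)" if \<omega>: "\<omega> \<in> space M" for \<omega>
  proof -
    define x where "x = (\<lambda>k. s k \<omega>)"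
    have p: "\<rho> \<omega> permutes I" by (rule permutes_rho[OF subset_refl \<rho> \<omega>])
    have gA: "g (profile I (\<lambda>k. A (?t j k)) \<omega>) = g (profile I s \<omega>)"
      if j: "j \<in> I" and tie: "A j \<omega> = s i \<omega>" for j
    proof -
      txt \<open>With a tie, \<open>q\<close> may move \<open>i\<close>, but only to an index with the same signal; \<open>q'\<close> undoes this.\<close>
      define q where "q = \<rho> \<omega> \<circ> ?t j"
      define q' where "q' = Transposition.transpose i (q i) \<circ> q"
      have qI: "q permutes I" unfolding q_def by (rule permutes_compose[OF tI[OF j] p])
      have xq: "x (q i) = x i" using tie by (simp add: q_def x_def A_def)
      have "q i \<in> I" using permutes_in_image[OF qI] i by simp
      then have "q' permutes I"
        unfolding q'_def by (intro permutes_compose[OF qI] permutes_swap_id i)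
      then have q': "q' permutes I - {i}"
        by (rule permutes_superset) (auto simp: q'_def)
      have "x (q' k) = x (q k)" for k
        using xq by (auto simp: q'_def Transposition.transpose_def)
      then have "(\<lambda>k\<in>I. x (q k)) = (\<lambda>k\<in>I. x (q' k))" by simp
      moreover have "profile I (\<lambda>k. A (?t j k)) \<omega> = (\<lambda>k\<in>I. x (q k))"
        by (simp add: profile_def A_def x_def q_def)
      ultimately show ?thesis using g(3)[OF q', of x] by (simp add: profile_def x_def)
    qed
    \<comment> \<open>Some position always matches, namely the one to which
      \<open>\<rho> \<omega>\<close> moved the signal of \<open>i\<close>, so \<open>G\<close> never
      divides by 0.\<close>
    have "inv (\<rho> \<omega>) i \<in> I" "A (inv (\<rho> \<omega>) i) \<omega> = s i \<omega>"
      using permutes_in_image[OF permutes_inv[OF p]] permutes_inverses(1)[OF p] i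
      by (simp_all add: A_def)
    then have "0 < count \<omega>"
      unfolding count_def using finite_I by (intro sum_pos2) auto
    moreover have "(\<Sum>j\<in>I. if A j \<omega> = s i \<omega> then g (profile I (\<lambda>k. A (?t j k)) \<omega>) else 0)
        = g (profile I s \<omega>) * count \<omega>"
      unfolding count_def sum_distrib_left by (intro sum.cong) (auto simp: gA)
    ultimately show ?thesis by (simp add: G_def)
  qed
  show ?thesis
    by (rule info_value_ge_version[OF K subalgebra_complete[OF subset_refl]
          w_int(1)[OF i] w_int(2)[OF i] GK])
      (use g(2) AE_space in eventually_elim, simp add: Gg)
qed

text \<open>The shuffled sample carries no labels. The integral of \<open>w i\<close> over one of
  its events is an average over all permutations \<open>p\<close>; swapping the names
  \<open>i\<close> and \<open>j\<close> sends the term of \<open>p\<close> for \<open>w i\<close> to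
  the term of \<open>\<tau> \<circ> p\<close> for \<open>w j\<close>, which only reorders the
  average.\<close>

lemma cond_exp_anonymized_eq:
  assumes i: "i \<in> I" and j: "j \<in> I" and unif: "uniform_permutation M I \<rho>"
    and ind: "independent_info M H (perm_info M I \<rho>)"
  shows "AE \<omega> in M. real_cond_exp M (anonymized_info M I s \<rho>) (w i) \<omega>
    = real_cond_exp M (anonymized_info M I s \<rho>) (w j) \<omega>"
proof -
  let ?Q = "{p. p permutes I}" and ?P = "profile_space I"
  let ?A = "anonymized_info M I s \<rho>" and ?S = "profile I (\<lambda>j \<omega>. s (\<rho> \<omega> j) \<omega>)"
  let ?S\<pi> = "\<lambda>p. profile I (\<lambda>j. s (p j))"
  have \<rho>: "\<rho> \<in> M \<rightarrow>\<^sub>M count_space ?Q"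
    and \<rho>_distr: "distr M (count_space ?Q) \<rho> = uniform_count_measure ?Q"
    using unif by (auto simp: uniform_permutation_def)
  have finQ: "finite ?Q" using finite_I by (rule finite_permutations)
  interpret sigma_finite_subalgebra M ?A
    by (rule sigma_finite_subalgebraI[OF subalgebra_anonymized[OF subset_refl \<rho>]])
  have S: "?S \<in> space M \<rightarrow> space ?P" by (auto simp: profile_def space_PiM)
  have prob_\<rho>: "prob (\<rho> -` {p} \<inter> space M) = 1 / card ?Q" if "p \<in> ?Q" for p
  proof -
    have "prob (\<rho> -` {p} \<inter> space M) = measure (distr M (count_space ?Q) \<rho>) {p}"
      using that by (intro measure_distr[OF \<rho>, symmetric]) auto
    then show ?thesis using finQ that by (simp add: \<rho>_distr measure_uniform_count_measure)
  qed
  \<comment> \<open>The space is split by the value of \<open>\<rho>\<close>. Independence from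
    \<open>H\<close> lets each event \<open>\<rho> = p\<close> factor out, and uniformity gives it
    the weight \<open>1 / card ?Q\<close>.\<close>
  have average: "(\<integral>\<omega>. w k \<omega> * indicator B (?S \<omega>) \<partial>M)
      = (\<Sum>p\<in>?Q. \<integral>\<omega>. w k \<omega> * indicator B (?S\<pi> p \<omega>) \<partial>M) / card ?Q"
    if k: "k \<in> I" and B: "B \<in> sets ?P" for k B
  proof -
    have wB: "(\<lambda>\<omega>. w k \<omega> * indicator B (?S\<pi> p \<omega>)) \<in> borel_measurable H" if "p \<in> ?Q" for p
      using that permutes_in_image[of p I]
      by (intro borel_measurable_times w_H[OF k] measurable_compose[OF profile_measurable[OF s_H]]
          borel_measurable_indicator B) auto
    have wBi: "integrable M (\<lambda>\<omega>. w k \<omega> * indicator B (?S\<pi> p \<omega>))" if "p \<in> ?Q" for p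
      using measurable_from_subalg[OF subalgebra_H wB[OF that]]
      by (intro Bochner_Integration.integrable_bound[OF w_int(1)[OF k]])
        (auto simp: indicator_def)
    have \<rho>set: "\<rho> -` {p} \<inter> space M \<in> events" if "p \<in> ?Q" for p
      using that by (intro measurable_sets[OF \<rho>]) auto
    have "(\<integral>\<omega>. w k \<omega> * indicator B (?S \<omega>) \<partial>M)
        = (\<integral>\<omega>. (\<Sum>p\<in>?Q. w k \<omega> * indicator B (?S\<pi> p \<omega>) * indicator (\<rho> -` {p} \<inter> space M) \<omega>) \<partial>M)"
    proof (intro Bochner_Integration.integral_cong refl)
      fix \<omega> assume \<omega>: "\<omega> \<in> space M"
      have "(\<Sum>p\<in>?Q. w k \<omega> * indicator B (?S\<pi> p \<omega>) * indicator (\<rho> -` {p} \<inter> space M) \<omega>)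
          = (\<Sum>p\<in>?Q. if p = \<rho> \<omega> then w k \<omega> * indicator B (?S\<pi> p \<omega>) else 0)"
        using \<omega> by (intro sum.cong) (auto simp: indicator_def)
      also have "\<dots> = w k \<omega> * indicator B (?S\<pi> (\<rho> \<omega>) \<omega>)"
        using finQ permutes_rho[OF subset_refl \<rho> \<omega>] by (simp add: sum.delta)
      finally show "w k \<omega> * indicator B (?S \<omega>)
        = (\<Sum>p\<in>?Q. w k \<omega> * indicator B (?S\<pi> p \<omega>) * indicator (\<rho> -` {p} \<inter> space M) \<omega>)"
        by (simp add: profile_def)
    qed
    also have "\<dots> = (\<Sum>p\<in>?Q. \<integral>\<omega>. w k \<omega> * indicator B (?S\<pi> p \<omega>) * indicator (\<rho> -` {p} \<inter> space M) \<omega> \<partial>M)"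
      using wBi \<rho>set
      by (intro Bochner_Integration.integral_sum integrable_real_mult_indicator) auto
    also have "\<dots> = (\<Sum>p\<in>?Q. (\<integral>\<omega>. w k \<omega> * indicator B (?S\<pi> p \<omega>) \<partial>M) / card ?Q)"
    proof (rule sum.cong[OF refl])
      fix p assume p: "p \<in> ?Q"
      have "\<rho> -` {p} \<inter> space M \<in> sets (perm_info M I \<rho>)"
        unfolding perm_info_def using p by (intro in_vimage_algebra) auto
      then show "(\<integral>\<omega>. w k \<omega> * indicator B (?S\<pi> p \<omega>) * indicator (\<rho> -` {p} \<inter> space M) \<omega> \<partial>M)
          = (\<integral>\<omega>. w k \<omega> * indicator B (?S\<pi> p \<omega>) \<partial>M) / card ?Q"
        using indep_set_integral_mult_indicator[OF subalgebra_H ind[unfolded independent_info_def]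
            wB[OF p] wBi[OF p]] prob_\<rho>[OF p] by simp
    qed
    finally show ?thesis by (simp add: sum_divide_distrib)
  qed
  have eq: "(\<integral>\<omega>. w i \<omega> * indicator B (?S \<omega>) \<partial>M) = (\<integral>\<omega>. w j \<omega> * indicator B (?S \<omega>) \<partial>M)"
    if B: "B \<in> sets ?P" for B
  proof -
    let ?\<tau> = "Transposition.transpose i j"
    have \<tau>: "?\<tau> permutes I" by (rule permutes_swap_id[OF i j])
    have "(\<integral>\<omega>. w i \<omega> * indicator B (?S\<pi> p \<omega>) \<partial>M) = (\<integral>\<omega>. w j \<omega> * indicator B (?S\<pi> (?\<tau> \<circ> p) \<omega>) \<partial>M)"
      if p: "p \<in> ?Q" for p
    proof -
      have pI: "p permutes I" using p by simp
      have perm: "(\<lambda>k\<in>I. profile I y \<omega> (p k)) = profile I (\<lambda>k. y (p k)) \<omega>"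
        for y :: "nat \<Rightarrow> 'a \<Rightarrow> real" and \<omega>
        using permutes_in_image[OF pI] by (auto simp: profile_def fun_eq_iff)
      have "(\<lambda>xy. fst xy * indicator B (\<lambda>k\<in>I. snd xy (p k)) :: real)
          \<in> borel_measurable (borel \<Otimes>\<^sub>M ?P)"
        by (intro borel_measurable_times measurable_fst
            measurable_compose[OF measurable_compose[OF measurable_snd permute_profile_measurable[OF pI]]]
            borel_measurable_indicator B)
      from integral_symmetric[OF \<tau> i subset_refl this] show ?thesis
        by (simp add: perm)
    qed
    then show ?thesis
      unfolding average[OF i B] average[OF j B]
      using setum_permutations_compose_left[OF \<tau>, of "\<lambda>p. \<integral>\<omega>. w j \<omega> * indicator B (?S\<pi> p \<omega>) \<partial>M"]
      by simp
  qed
  show ?thesis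
  proof (rule real_cond_exp_charact[OF _ w_int(1)[OF i]])
    fix C assume C: "C \<in> sets ?A"
    then obtain B where B: "B \<in> sets ?P" "C = ?S -` B \<inter> space M"
      by (auto simp: anonymized_info_def sets_vimage_algebra2[OF S])
    have ind_C: "(\<integral>\<omega>\<in>C. f \<omega> \<partial>M) = (\<integral>\<omega>. f \<omega> * indicator B (?S \<omega>) \<partial>M)" for f :: "'a \<Rightarrow> real"
      unfolding set_lebesgue_integral_def B(2)
      by (intro Bochner_Integration.integral_cong) (auto simp: indicator_def)
    have "(\<integral>\<omega>\<in>C. w i \<omega> \<partial>M) = (\<integral>\<omega>\<in>C. w j \<omega> \<partial>M)" unfolding ind_C by (rule eq[OF B(1)])
    also have "\<dots> = (\<integral>\<omega>\<in>C. real_cond_exp M ?A (w j) \<omega> \<partial>M)"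
      by (rule real_cond_exp_intA[OF w_int(1)[OF j] C])
    finally show "(\<integral>\<omega>\<in>C. w i \<omega> \<partial>M) = (\<integral>\<omega>\<in>C. real_cond_exp M ?A (w j) \<omega> \<partial>M)" .
  qed (use real_cond_exp_int[OF w_int(1)[OF j]] in auto)
qed

text \<open>Both posterior means are tested against the observed \<open>s i\<close>. By independence
  and equal means the error adds the same amount on both sides, which leaves
  \<open>E[w_i\<^sup>2] = E[w_j w_i]\<close>; as second moments agree,
  \<open>E[(w_i - w_j)\<^sup>2] = 0\<close>.\<close>

lemma cond_exp_complete_eq_imp:
  assumes i: "i \<in> I" and j: "j \<in> I"
    and eq: "AE \<omega> in M. real_cond_exp M (complete_info M I s) (w i) \<omega>
      = real_cond_exp M (complete_info M I s) (w j) \<omega>"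
  shows "AE \<omega> in M. w i \<omega> = w j \<omega>"
proof -
  let ?F = "complete_info M I s"
  note F = subalgebra_complete[OF subset_refl]
  have prod: "integrable M (\<lambda>\<omega>. w k \<omega> * w l \<omega>)" "integrable M (\<lambda>\<omega>. w k \<omega> * e l \<omega>)"
    if "k \<in> I" "l \<in> I" for k l
    using that w_int e_int by (auto intro!: integrable_mult_square)
  have si: "s i \<in> borel_measurable ?F" by (rule measurable_complete_info[OF i])
  have ws: "(\<integral>\<omega>. w k \<omega> * s i \<omega> \<partial>M)
      = expectation (\<lambda>\<omega>. w k \<omega> * w i \<omega>) + \<sigma> * (expectation (w k) * expectation (e i))"
    if k: "k \<in> I" for k
  proof -
    have "(\<integral>\<omega>. w k \<omega> * s i \<omega> \<partial>M) = (\<integral>\<omega>. w k \<omega> * w i \<omega> + \<sigma> * (w k \<omega> * e i \<omega>) \<partial>M)"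
      by (intro Bochner_Integration.integral_cong) (auto simp: signal_def algebra_simps)
    then show ?thesis using prod[OF k i] indep_w_e[OF k i] by simp
  qed
  have "(\<integral>\<omega>. w i \<omega> * s i \<omega> \<partial>M) = (\<integral>\<omega>. real_cond_exp M ?F (w i) \<omega> * s i \<omega> \<partial>M)"
    by (rule cond_exp_inner[OF F w_int(1)[OF i] w_int(2)[OF i] si s_square_int[OF i], symmetric])
  also have "\<dots> = (\<integral>\<omega>. real_cond_exp M ?F (w j) \<omega> * s i \<omega> \<partial>M)"
    using eq s_meas[OF i] by (intro integral_cong_AE) auto
  also have "\<dots> = (\<integral>\<omega>. w j \<omega> * s i \<omega> \<partial>M)"
    by (rule cond_exp_inner[OF F w_int(1)[OF j] w_int(2)[OF j] si s_square_int[OF i]])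
  finally have cross: "expectation (\<lambda>\<omega>. w i \<omega> * w i \<omega>) = expectation (\<lambda>\<omega>. w j \<omega> * w i \<omega>)"
    using ws[OF i] ws[OF j] expectation_exchange[OF i j, of "\<lambda>x. x"] by simp
  have square: "expectation (\<lambda>\<omega>. w j \<omega> * w j \<omega>) = expectation (\<lambda>\<omega>. w i \<omega> * w i \<omega>)"
    using expectation_exchange[OF i j, of "\<lambda>x. x * x"] by simp
  have expand: "(w i \<omega> - w j \<omega>)\<^sup>2 = w i \<omega> * w i \<omega> + w j \<omega> * w j \<omega> - 2 * (w j \<omega> * w i \<omega>)" for \<omega>
    by (simp add: power2_eq_square algebra_simps)
  have "integrable M (\<lambda>\<omega>. (w i \<omega> - w j \<omega>)\<^sup>2)"
    unfolding expand using prod[OF i i] prod[OF j j] prod[OF j i] by simp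
  moreover have "(\<integral>\<omega>. (w i \<omega> - w j \<omega>)\<^sup>2 \<partial>M) = 0"
    unfolding expand using prod[OF i i] prod[OF j j] prod[OF j i] cross square by simp
  ultimately have "AE \<omega> in M. (w i \<omega> - w j \<omega>)\<^sup>2 = 0"
    using integral_nonneg_eq_0_iff_AE[of M "\<lambda>\<omega>. (w i \<omega> - w j \<omega>)\<^sup>2"] by simp
  then show ?thesis by eventually_elim simp
qed

section \<open>The intermediary's profit in information values, and the comparison of the
  policies\<close>

lemma intermediary_profit_eq_info_value:
  assumes X: "subalgebra M X" and Xm: "\<forall>i\<in>I. subalgebra M (Xm i)"
  shows "intermediary_profit M I c w s X Xm = (\<Sum>i\<in>I.
      - info_value M (w i) X / 8 + 3 / 8 * info_value M (w i) (Xm i)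
      + info_value M (w i) (info_join (own_info M s i) X) / 2
      - info_value M (w i) (info_join (own_info M s i) (Xm i)) / 2
      - info_value M (w i) (no_info M) / 4)"
proof -
  have none: "subalgebra M (no_info M)" by (auto simp: no_info_def subalgebra_def sigma_sets_empty_eq)
  show ?thesis
    unfolding intermediary_profit_def producer_payment_def consumer_payment_def
      sum_subtractf[symmetric]
  proof (rule sum.cong[OF refl])
    fix i assume i: "i \<in> I"
    note own = subalgebra_own[OF i] and wi = w_int(1)[OF i] w_int(2)[OF i]
    have e: "sets (no_info M) \<subseteq> sets (own_info M s i)"
      using sets.top[of "own_info M s i"] by (auto simp: no_info_def own_info_def sigma_sets_empty_eq)
    \<comment> \<open>Per unit of value, better producer information adds \<open>1/4\<close> to
      profit and takes \<open>3/8\<close> from surplus, hence \<open>- 1/8\<close> for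
      \<open>X\<close>; the \<open>3/8\<close> for \<open>Xm i\<close> stems from the surplus after
      a refusal. The terms in \<open>c\<close> cancel in the differences.\<close>
    show "profit M c (w i) (info_join (own_info M s i) X) X
          - profit M c (w i) (own_info M s i) (no_info M)
        - (surplus M c (w i) (info_join (own_info M s i) (Xm i)) (Xm i)
          - surplus M c (w i) (info_join (own_info M s i) X) X)
      = - info_value M (w i) X / 8 + 3 / 8 * info_value M (w i) (Xm i)
      + info_value M (w i) (info_join (own_info M s i) X) / 2
      - info_value M (w i) (info_join (own_info M s i) (Xm i)) / 2
      - info_value M (w i) (no_info M) / 4"
      unfolding profit_eq_info_value[OF own none e wi]
        profit_eq_info_value[OF subalgebra_info_join[OF own X] X sets_info_join_upper2[OF own X] wi]
        surplus_eq_info_value[OF subalgebra_info_join[OF own X] X wi]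
        surplus_eq_info_value[OF subalgebra_info_join[OF own bspec[OF Xm i]] bspec[OF Xm i] wi]
      by (simp add: field_simps)
  qed
qed

text \<open>Assumption \<open>ne\<close> excludes a common willingness to pay. In that case the
  posterior means would be symmetric in all signals, hence recoverable from shuffled data, and both
  policies would earn the same.\<close>

theorem anonymized_profit_gt:
  assumes ne: "\<exists>i\<in>I. \<exists>j\<in>I. \<not> (AE \<omega> in M. w i \<omega> = w j \<omega>)"
    and unif: "uniform_permutation M I \<rho>"
    and ind: "independent_info M H (perm_info M I \<rho>)"
    and unif_m: "\<And>i. i \<in> I \<Longrightarrow> uniform_permutation M (I - {i}) (\<rho>m i)"
    and ind_m: "\<And>i. i \<in> I \<Longrightarrow> independent_info M H (perm_info M (I - {i}) (\<rho>m i))"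
  shows "complete_data_profit M I c w s < anonymized_data_profit M I c w s \<rho> \<rho>m"
proof -
  let ?V = "\<lambda>i. info_value M (w i)" and ?own = "own_info M s"
  let ?S = "complete_info M I s" and ?A = "anonymized_info M I s \<rho>"
  let ?Sm = "\<lambda>i. complete_info M (I - {i}) s"
  let ?Am = "\<lambda>i. anonymized_info M (I - {i}) s (\<rho>m i)"
  have \<rho>: "\<rho> \<in> M \<rightarrow>\<^sub>M count_space {p. p permutes I}"
    using unif by (simp add: uniform_permutation_def)
  have \<rho>m: "\<rho>m i \<in> M \<rightarrow>\<^sub>M count_space {p. p permutes (I - {i})}" if "i \<in> I" for i
    using unif_m[OF that] by (simp add: uniform_permutation_def)
  have Im: "I - {i} \<subseteq> I" for i by auto
  note S = subalgebra_complete[OF subset_refl] and Sm = subalgebra_complete[OF Im]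
    and A = subalgebra_anonymized[OF subset_refl \<rho>] and Am = subalgebra_anonymized[OF Im \<rho>m]
  note S\<rho> = subalgebra_info_join[OF S subalgebra_perm[OF subset_refl \<rho>]]
  \<comment> \<open>The signals joined with the permutation refine both \<open>?A\<close> and
    \<open>?S\<close>, and are worth exactly as much as \<open>?S\<close>. If \<open>?A\<close> is
    worth the same too, both posterior means coincide with the one given the refinement.\<close>
  have A_le: "?V i ?A \<le> ?V i ?S" and A_eq: "?V i ?A = ?V i ?S \<Longrightarrow>
      AE \<omega> in M. real_cond_exp M ?A (w i) \<omega> = real_cond_exp M ?S (w i) \<omega>" if i: "i \<in> I" for i
  proof -
    let ?J = "info_join ?S (perm_info M I \<rho>)"
    note wi = w_int(1)[OF i] w_int(2)[OF i]
    note AJ = info_value_mono[OF A S\<rho> sets_anonymized_subset[OF subset_refl \<rho> subset_refl subset_refl] wi]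
    note SJ = info_value_mono[OF S S\<rho> sets_info_join_upper1[OF S subalgebra_perm[OF subset_refl \<rho>]] wi]
    have J: "?V i ?J = ?V i ?S" by (rule info_value_perm_join[OF subset_refl \<rho> ind subset_refl i])
    show "?V i ?A \<le> ?V i ?S" using AJ(1) J by simp
    assume "?V i ?A = ?V i ?S"
    then have "AE \<omega> in M. real_cond_exp M ?A (w i) \<omega> = real_cond_exp M ?J (w i) \<omega>"
      "AE \<omega> in M. real_cond_exp M ?S (w i) \<omega> = real_cond_exp M ?J (w i) \<omega>"
      using AJ(2) SJ(2) J by simp_all
    then show "AE \<omega> in M. real_cond_exp M ?A (w i) \<omega> = real_cond_exp M ?S (w i) \<omega>"
      by eventually_elim simp
  qed
  \<comment> \<open>Without a strict gap for some consumer,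
    \<open>E[w_i|S] = E[w_i|A] = E[w_j|A] = E[w_j|S]\<close> would hold almost surely for all
    \<open>i\<close> and \<open>j\<close>.\<close>
  have strict: "\<exists>i\<in>I. ?V i ?A < ?V i ?S"
  proof (rule ccontr)
    assume "\<not> (\<exists>i\<in>I. ?V i ?A < ?V i ?S)"
    then have VA: "?V i ?A = ?V i ?S" if "i \<in> I" for i using A_le[OF that] that by fastforce
    obtain i j where ij: "i \<in> I" "j \<in> I" and "\<not> (AE \<omega> in M. w i \<omega> = w j \<omega>)" using ne by blast
    moreover have "AE \<omega> in M. real_cond_exp M ?S (w i) \<omega> = real_cond_exp M ?S (w j) \<omega>"
      using A_eq[OF ij(1) VA[OF ij(1)]] A_eq[OF ij(2) VA[OF ij(2)]]
        cond_exp_anonymized_eq[OF ij unif ind] by eventually_elim simp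
    ultimately show False using cond_exp_complete_eq_imp[OF ij] by blast
  qed
  have others: "?V i (?Sm i) \<le> ?V i (?Am i)" if i: "i \<in> I" for i
    by (rule info_value_anonymized_others[OF i _ Im \<rho>m[OF i]]) simp
  \<comment> \<open>The own signal and those of the others generate the complete sample, so a
    consumer's participation teaches her nothing under complete data.\<close>
  have own_le: "?V i (info_join (?own i) ?S) \<le> ?V i (info_join (?own i) (?Sm i))" if i: "i \<in> I" for i
  proof (rule info_value_mono(1)[OF _ _ _ w_int(1)[OF i] w_int(2)[OF i]])
    let ?K = "info_join (?own i) (?Sm i)"
    note own = subalgebra_own[OF i]
    show K: "subalgebra M ?K" by (rule subalgebra_info_join[OF own Sm])
    show "subalgebra M (info_join (?own i) ?S)" by (rule subalgebra_info_join[OF own S])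
    have "s j \<in> borel_measurable ?K" if "j \<in> I" for j
    proof (cases "j = i")
      case True
      show ?thesis unfolding True
        by (rule measurable_subalgebra_mono[OF own K sets_info_join_upper1[OF own Sm]])
          (simp add: own_info_def measurable_vimage_algebra1)
    next
      case False
      then show ?thesis using that
        by (intro measurable_subalgebra_mono[OF Sm K sets_info_join_upper2[OF own Sm]]
            measurable_complete_info) auto
    qed
    then have "sets ?S \<subseteq> sets ?K"
      unfolding complete_info_def[of M I s]
      by (intro sets_vimage_algebra_least[OF K] profile_measurable)
    then show "sets (info_join (?own i) ?S) \<subseteq> sets ?K"
      by (intro sets_info_join_least[OF own S K] sets_info_join_upper1[OF own Sm])
  qed
  \<comment> \<open>The chain passes through \<open>?V i ?S\<close>: the own signal and the shuffle
    of the others are functions of all signals and an uninformative permutation, while the own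
    signal with the full shuffle is worth at least the complete sample.\<close>
  have own_ge: "?V i (info_join (?own i) (?Am i)) \<le> ?V i (info_join (?own i) ?A)" if i: "i \<in> I" for i
  proof -
    let ?J = "info_join ?S (perm_info M (I - {i}) (\<rho>m i))"
    note own = subalgebra_own[OF i] and Pm = subalgebra_perm[OF Im \<rho>m[OF i]]
    have J: "subalgebra M ?J" by (rule subalgebra_info_join[OF S Pm])
    have "s i \<in> borel_measurable ?J"
      by (rule measurable_subalgebra_mono[OF S J sets_info_join_upper1[OF S Pm]
            measurable_complete_info[OF i]])
    then have "sets (?own i) \<subseteq> sets ?J"
      unfolding own_info_def by (rule sets_vimage_algebra_least[OF J])
    moreover have "sets (?Am i) \<subseteq> sets ?J"
      by (rule sets_anonymized_subset[OF Im \<rho>m[OF i] Im subset_refl])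
    ultimately have "sets (info_join (?own i) (?Am i)) \<subseteq> sets ?J"
      by (rule sets_info_join_least[OF own Am[OF i] J])
    then have "?V i (info_join (?own i) (?Am i)) \<le> ?V i ?J"
      by (rule info_value_mono(1)[OF subalgebra_info_join[OF own Am[OF i]] J _ w_int(1)[OF i] w_int(2)[OF i]])
    also have "\<dots> = ?V i ?S" by (rule info_value_perm_join[OF Im \<rho>m[OF i] ind_m[OF i] subset_refl i])
    also have "\<dots> \<le> ?V i (info_join (?own i) ?A)" by (rule info_value_own_anonymized[OF i \<rho>])
    finally show ?thesis .
  qed
  have "\<forall>i\<in>I. subalgebra M (?Sm i)" "\<forall>i\<in>I. subalgebra M (?Am i)" using Sm Am by blast+
  note profits = intermediary_profit_eq_info_value[OF S this(1)]
    intermediary_profit_eq_info_value[OF A this(2)]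
  show ?thesis
    unfolding complete_data_profit_def anonymized_data_profit_def profits
  \<comment> \<open>The sums are compared consumer by consumer; the negative coefficient of the
    value of \<open>X\<close> turns the strict loss of value for one consumer into a strict gain in
    profit.\<close>
  proof (rule sum_strict_mono_ex1[OF finite_I])
    show "\<forall>i\<in>I. - ?V i ?S / 8 + 3 / 8 * ?V i (?Sm i) + ?V i (info_join (?own i) ?S) / 2
        - ?V i (info_join (?own i) (?Sm i)) / 2 - ?V i (no_info M) / 4
      \<le> - ?V i ?A / 8 + 3 / 8 * ?V i (?Am i) + ?V i (info_join (?own i) ?A) / 2
        - ?V i (info_join (?own i) (?Am i)) / 2 - ?V i (no_info M) / 4"
    proof
      fix i assume i: "i \<in> I"
      show "- ?V i ?S / 8 + 3 / 8 * ?V i (?Sm i) + ?V i (info_join (?own i) ?S) / 2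
        - ?V i (info_join (?own i) (?Sm i)) / 2 - ?V i (no_info M) / 4
      \<le> - ?V i ?A / 8 + 3 / 8 * ?V i (?Am i) + ?V i (info_join (?own i) ?A) / 2
        - ?V i (info_join (?own i) (?Am i)) / 2 - ?V i (no_info M) / 4"
        using A_le[OF i] others[OF i] own_le[OF i] own_ge[OF i] by linarith
    qed
    from strict obtain i where i: "i \<in> I" and lt: "?V i ?A < ?V i ?S" by blast
    show "\<exists>i\<in>I. - ?V i ?S / 8 + 3 / 8 * ?V i (?Sm i) + ?V i (info_join (?own i) ?S) / 2
        - ?V i (info_join (?own i) (?Sm i)) / 2 - ?V i (no_info M) / 4
      < - ?V i ?A / 8 + 3 / 8 * ?V i (?Am i) + ?V i (info_join (?own i) ?A) / 2
        - ?V i (info_join (?own i) (?Am i)) / 2 - ?V i (no_info M) / 4"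
      using lt others[OF i] own_le[OF i] own_ge[OF i] by (intro bexI[OF _ i]) linarith
  qed
qed

end

theorem proposition3:
  fixes M :: "'a measure" and N :: nat and w e :: "nat \<Rightarrow> 'a \<Rightarrow> real"
    and \<mu> \<sigma> c :: real
    and \<rho> :: "'a \<Rightarrow> nat \<Rightarrow> nat" and \<rho>m :: "nat \<Rightarrow> 'a \<Rightarrow> nat \<Rightarrow> nat"
  assumes prob: "prob_space M"
    and many_consumers: "N \<ge> 2"
    and sigma_pos: "\<sigma> > 0"
    and cost_nonneg: "c \<ge> 0"
    and w_integrable: "\<And>i. i \<in> {1..N} \<Longrightarrow> integrable M (w i) \<and> integrable M (\<lambda>\<omega>. (w i \<omega>)\<^sup>2)"
    and e_integrable: "\<And>i. i \<in> {1..N} \<Longrightarrow> integrable M (e i) \<and> integrable M (\<lambda>\<omega>. (e i \<omega>)\<^sup>2)"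
    and w_moments: "\<And>i. i \<in> {1..N} \<Longrightarrow>
           prob_space.expectation M (w i) = \<mu> \<and> prob_space.variance M (w i) = 1"
    and e_moments: "\<And>i. i \<in> {1..N} \<Longrightarrow>
           prob_space.expectation M (e i) = 0 \<and> prob_space.variance M (e i) = 1"
    and w_symmetric: "symmetric_distr M {1..N} w"
    and e_symmetric: "symmetric_distr M {1..N} e"
    and w_e_independent: "independent_info M (complete_info M {1..N} w) (complete_info M {1..N} e)"
    and w_not_all_equal: "\<exists>i\<in>{1..N}. \<exists>j\<in>{1..N}. \<not> (AE \<omega> in M. w i \<omega> = w j \<omega>)"
    and perm_uniform: "uniform_permutation M {1..N} \<rho>"
    and perm_independent:
      "independent_info M (info_join (complete_info M {1..N} w) (complete_info M {1..N} e))
         (perm_info M {1..N} \<rho>)"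
    and perm_without_uniform:
      "\<And>i. i \<in> {1..N} \<Longrightarrow> uniform_permutation M ({1..N} - {i}) (\<rho>m i)"
    and perm_without_independent:
      "\<And>i. i \<in> {1..N} \<Longrightarrow>
         independent_info M (info_join (complete_info M {1..N} w) (complete_info M {1..N} e))
           (perm_info M ({1..N} - {i}) (\<rho>m i))"
  shows "anonymized_data_profit M {1..N} c w (signal \<sigma> w e) \<rho> \<rho>m
           > complete_data_profit M {1..N} c w (signal \<sigma> w e)"
proof -
  interpret prob: prob_space M by (rule prob)
  interpret symmetric_market M "{1..N}" w e \<sigma>
    by unfold_locales
      (simp_all only: finite_atLeastAtMost w_integrable e_integrable w_symmetric e_symmetric
        w_e_independent)
  show ?thesis
    by (rule anonymized_profit_gt[OF w_not_all_equal perm_uniform perm_independent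
          perm_without_uniform perm_without_independent])
qed

end
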